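(* Let $q$ be a prime power and $n$ a positive integer with $\gcd(n,q)=1$. Let $D$ be a cyclic code of length $n$ over $\mathbf{F}_{q^2}$ such that $D\subseteq D^{\perp_h}$. Let $T_D$ and $T_{D^{\perp_h}}$ be the defining sets of $D$ and $D^{\perp_h}$, respectively. If $T$ is a subset of $T_D\setminus T_{D^{\perp_h}}$ that is a union of cyclotomic cosets, then one can define a cyclic code $C$ of length $n$ over $\mathbf{F}_{q^2}$ with defining set $T_C=T_D\setminus(T\cup T^{-q})$. If $n-k=|T_D|$ and $r=|T\cup T^{-q}|$ with $0\le r<n-2k$, and $d=\mathrm{wt}(D^{\perp_h}\setminus C)$, then there exists an $[[n,n-2k-r,r,d]]_q$ subsystem code.
   Context: Cyclic codes over $\mathbf{F}_{q^2}$: a linear code $C\subseteq\mathbf{F}_{q^2}^n$ is cyclic if it is closed under cyclic shifts; identify $(c_0,\dots,c_{n-1})$ with $c_0+c_1x+\cdots+c_{n-1}x^{n-1}$ in $\mathbf{F}_{q^2}[x]/(x^n-1)$, so that a cyclic code is an ideal generated by a unique monic divisor $g(x)$ of $x^n-1$. Fix a primitive $n$-th root of unity $\alpha$ over $\mathbf{F}_{q^2}$. The defining set of $C$ is the set $T\subseteq N=\{0,\dots,n-1\}$ with $g(x)=\prod_{t\in T}(x-\alpha^t)$; it is a union of cyclotomic cosets $C_x=\{xq^{2i}\bmod n : i\ge 0\}$. For an integer $a$, $T^a=\{at\bmod n : t\in T\}$. $D^{\perp_h}$ is the Hermitian dual with respect to $\langle x|y\rangle_h=\sum_i x_i^qy_i$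 on $\mathbf{F}_{q^2}^n$. $\mathrm{wt}(S)$ is the minimum Hamming weight of the nonzero vectors in $S$. Subsystem codes: let $p$ be the characteristic of $\mathbf{F}_q$. For $(x|y)\in\mathbf{F}_q^{2n}$ (with $x,y\in\mathbf{F}_q^n$), $\mathrm{swt}(x|y)$ is the number of $i$ with $(x_i,y_i)\ne(0,0)$, and $\mathrm{swt}(S)$ is the minimum of $\mathrm{swt}$ over the nonzero elements of $S$. The trace-symplectic product of $(a|b)$ and $(a'|b')$ is $\mathrm{tr}_{q/p}(a'\cdot b-a\cdot b')$, and $X^{\perp_s}$ is the dual of $X\subseteq\mathbf{F}_q^{2n}$ with respect to it. All subsystem codes are Clifford subsystem codes: an $((n,K,R,d))_q$ subsystem code is a subspace $Q=A\otimes B$ of $\mathbf{C}^{q^n}$, $\dim A=K$, $\dim B=R$, arising from an additive code; concretely, its existence means that there is an additive subgroup $X\le\mathbf{F}_q^{2n}$ (the zero code is allowed) with $Y=X\cap X^{\perp_s}$ such that $|X|=q^nR/K$, $|Y|=q^n/(KR)$, and $d=\mathrm{swt}(Y^{\perp_s}\setminus X)$ if $Y^{\perp_s}\ne X$, while $d=\mathrm{swt}(Y^{\perp_s})$ if $Y^{\perp_s}=X$ (the case $K=1$). $[[n,k,r,d]]_q$ means $((n,q^k,q^r,d))_q$. *)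

theory Defs
  imports
    "HOL-Library.Cardinality"
    "HOL-Number_Theory.Number_Theory"
    "HOL-Algebra.Algebraic_Closure_Type"
    "Jordan_Normal_Form.Matrix"
begin

section \<open>Cyclic codes\<close>

definition linear_code :: "nat \<Rightarrow> 'a :: field vec set \<Rightarrow> bool" where
  "linear_code n C \<longleftrightarrow>
     C \<subseteq> carrier_vec n \<and> 0\<^sub>v n \<in> C \<and>
     (\<forall>x\<in>C. \<forall>y\<in>C. x + y \<in> C) \<and> (\<forall>a. \<forall>x\<in>C. a \<cdot>\<^sub>v x \<in> C)"

text \<open>The shift sends \<open>(c\<^sub>0, \<dots>, c\<^sub>n\<^sub>-\<^sub>1)\<close> to
  \<open>(c\<^sub>n\<^sub>-\<^sub>1, c\<^sub>0, \<dots>, c\<^sub>n\<^sub>-\<^sub>2)\<close>.\<close>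
definition cyclic_shift :: "nat \<Rightarrow> 'a vec \<Rightarrow> 'a vec" where
  "cyclic_shift n c = vec n (\<lambda>i. c $ ((i + n - 1) mod n))"

definition cyclic_code :: "nat \<Rightarrow> 'a :: field vec set \<Rightarrow> bool" where
  "cyclic_code n C \<longleftrightarrow> linear_code n C \<and> (\<forall>c\<in>C. cyclic_shift n c \<in> C)"

definition code_poly :: "'a :: zero vec \<Rightarrow> 'a poly" where
  "code_poly c = Poly (list_of_vec c)"

text \<open>The code is the ideal generated by \<open>g\<close> in the quotient of the polynomial ring
  by \<open>x\<^sup>n - 1\<close>, whose elements are represented by words of length \<open>n\<close>.\<close>
definition is_generator_poly :: "nat \<Rightarrow> 'a :: field vec set \<Rightarrow> 'a poly \<Rightarrow> bool" where
  "is_generator_poly n C g \<longleftrightarrow>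
     lead_coeff g = 1 \<and> g dvd Polynomial.monom 1 n - 1 \<and>
     C = {c \<in> carrier_vec n. \<exists>a. [code_poly c = a * g] (mod (Polynomial.monom 1 n - 1))}"

definition primitive_root_of_unity :: "nat \<Rightarrow> 'a :: field \<Rightarrow> bool" where
  "primitive_root_of_unity n \<alpha> \<longleftrightarrow> \<alpha> ^ n = 1 \<and> (\<forall>j. 0 < j \<and> j < n \<longrightarrow> \<alpha> ^ j \<noteq> 1)"

text \<open>The \<open>n\<close>-th roots of unity live in the algebraic closure of the alphabet,
  so the factorisation is stated there.\<close>
definition is_defining_set ::
    "'a :: field alg_closure \<Rightarrow> nat \<Rightarrow> 'a vec set \<Rightarrow> nat set \<Rightarrow> bool" where
  "is_defining_set \<alpha> n C T \<longleftrightarrow>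
     T \<subseteq> {..<n} \<and>
     (\<exists>g. is_generator_poly n C g \<and> map_poly to_ac g = (\<Prod>t\<in>T. [:- (\<alpha> ^ t), 1:]))"

text \<open>Meaningful when \<open>C\<close> is cyclic of length \<open>n\<close> and \<open>\<alpha>\<close> is a primitive \<open>n\<close>-th root of
  unity; the set is then unique.\<close>
definition defining_set :: "'a :: field alg_closure \<Rightarrow> nat \<Rightarrow> 'a vec set \<Rightarrow> nat set" where
  "defining_set \<alpha> n C = (THE T. is_defining_set \<alpha> n C T)"

text \<open>Cosets for an alphabet with \<open>q\<^sup>2\<close> elements.\<close>
definition cyclotomic_coset :: "nat \<Rightarrow> nat \<Rightarrow> nat \<Rightarrow> nat set" where
  "cyclotomic_coset q n x = {x * q ^ (2 * i) mod n | i. True}"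

definition union_of_cyclotomic_cosets :: "nat \<Rightarrow> nat \<Rightarrow> nat set \<Rightarrow> bool" where
  "union_of_cyclotomic_cosets q n T \<longleftrightarrow> (\<exists>S\<subseteq>{..<n}. T = (\<Union>x\<in>S. cyclotomic_coset q n x))"

text \<open>The set written \<open>T\<^sup>a\<close>, for an integer \<open>a\<close>.\<close>
definition set_mult_mod :: "nat \<Rightarrow> int \<Rightarrow> nat set \<Rightarrow> nat set" where
  "set_mult_mod n a T = (\<lambda>t. nat ((a * int t) mod int n)) ` T"

definition hermitian_prod :: "nat \<Rightarrow> 'a :: field vec \<Rightarrow> 'a vec \<Rightarrow> 'a" where
  "hermitian_prod q x y = (\<Sum>i<dim_vec x. (x $ i) ^ q * y $ i)"

definition hermitian_dual :: "nat \<Rightarrow> nat \<Rightarrow> 'a :: field vec set \<Rightarrow> 'a vec set" where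
  "hermitian_dual q n D = {y \<in> carrier_vec n. \<forall>x\<in>D. hermitian_prod q x y = 0}"

definition hamming_wt :: "'a :: zero vec \<Rightarrow> nat" where
  "hamming_wt x = card {i. i < dim_vec x \<and> x $ i \<noteq> 0}"

definition min_wt :: "'a :: zero vec set \<Rightarrow> nat" where
  "min_wt S = Min (hamming_wt ` {x \<in> S. x \<noteq> 0\<^sub>v (dim_vec x)})"


section \<open>Subsystem codes\<close>

text \<open>The trace from the field \<open>'b\<close> of order \<open>p\<^sup>m\<close> to its prime field,
  viewed as a map from \<open>'b\<close> to \<open>'b\<close>; here \<open>p = CHAR('b)\<close> and the multiplicity is \<open>m\<close>.\<close>
definition abs_trace :: "'b :: {finite, field} \<Rightarrow> 'b" where
  "abs_trace x = (\<Sum>i<multiplicity CHAR('b) CARD('b). x ^ (CHAR('b) ^ i))"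

text \<open>The vector \<open>(x|y)\<close> of length \<open>2n\<close> is encoded as the pair \<open>(x, y)\<close> of vectors of
  length \<open>n\<close>.\<close>

definition trace_symplectic ::
    "'b :: {finite, field} vec \<times> 'b vec \<Rightarrow> 'b vec \<times> 'b vec \<Rightarrow> 'b" where
  "trace_symplectic = (\<lambda>(a, b) (a', b'). abs_trace (a' \<bullet> b - a \<bullet> b'))"

definition symplectic_dual ::
    "nat \<Rightarrow> ('b :: {finite, field} vec \<times> 'b vec) set \<Rightarrow> ('b vec \<times> 'b vec) set" where
  "symplectic_dual n U =
     {v \<in> carrier_vec n \<times> carrier_vec n. \<forall>u\<in>U. trace_symplectic u v = 0}"

definition swt :: "'b :: zero vec \<times> 'b vec \<Rightarrow> nat" where
  "swt = (\<lambda>(x, y). card {i. i < dim_vec x \<and> (x $ i, y $ i) \<noteq> (0, 0)})"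

definition min_swt :: "('b :: zero vec \<times> 'b vec) set \<Rightarrow> nat" where
  "min_swt S = Min (swt ` {(x, y) \<in> S. (x, y) \<noteq> (0\<^sub>v (dim_vec x), 0\<^sub>v (dim_vec y))})"

definition additive_code :: "nat \<Rightarrow> ('b :: field vec \<times> 'b vec) set \<Rightarrow> bool" where
  "additive_code n U \<longleftrightarrow>
     U \<subseteq> carrier_vec n \<times> carrier_vec n \<and> (0\<^sub>v n, 0\<^sub>v n) \<in> U \<and>
     (\<forall>(x, y)\<in>U. \<forall>(x', y')\<in>U. (x + x', y + y') \<in> U) \<and>
     (\<forall>(x, y)\<in>U. (- x, - y) \<in> U)"

text \<open>\<open>U\<close> is the additive code of a Clifford subsystem code with parameters
  \<open>((n, K, R, d))\<^sub>q\<close>, where \<open>q = CARD('b)\<close>.\<close>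
definition subsystem_code ::
    "nat \<Rightarrow> nat \<Rightarrow> nat \<Rightarrow> nat \<Rightarrow> ('b :: {finite, field} vec \<times> 'b vec) set \<Rightarrow> bool" where
  "subsystem_code n K R d U \<longleftrightarrow>
     (let V = U \<inter> symplectic_dual n U in
      additive_code n U \<and>
      real (card U) = real CARD('b) ^ n * real R / real K \<and>
      real (card V) = real CARD('b) ^ n / (real K * real R) \<and>
      d = (if symplectic_dual n V \<noteq> U then min_swt (symplectic_dual n V - U)
           else min_swt (symplectic_dual n V)))"

text \<open>There exists a code with parameters \<open>[[n, k, r, d]]\<^sub>q\<close>, where \<open>q = CARD('b)\<close>.\<close>
definition subsystem_code_exists ::
    "'b :: {finite, field} itself \<Rightarrow> nat \<Rightarrow> nat \<Rightarrow> nat \<Rightarrow> nat \<Rightarrow> bool" where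
  "subsystem_code_exists _ n k r d \<longleftrightarrow>
     (\<exists>U :: ('b vec \<times> 'b vec) set. subsystem_code n (CARD('b) ^ k) (CARD('b) ^ r) d U)"

end

theory Submission
  imports Defs "Jordan_Normal_Form.Char_Poly"
begin

text \<open>
  A cyclic code is the set of words \<open>c\<close> whose transform, with values \<open>c(\<alpha>\<^sup>t)\<close> for \<open>t < n\<close>, vanishes
  on the defining set.  The transform turns the cross-correlation of two words into a product, so
  the Hermitian dual of the code with defining set \<open>T\<close> has the complement of \<open>\<sigma> ` T\<close> as defining
  set, where \<open>\<sigma>\<close> is multiplication by \<open>-q\<close> modulo \<open>n\<close>.  The set \<open>S = T \<union> \<sigma> ` T\<close> is stable under
  \<open>\<sigma>\<close>; hence the Hermitian dual of \<open>C\<close> has as defining set that of the dual of \<open>D\<close> together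
  with \<open>S\<close>, and \<open>C\<close> meets its dual exactly in \<open>D\<close>.  Writing letters in coordinates with respect
  to a basis \<open>1, \<beta>\<close> over the subfield with \<open>q\<close> elements turns \<open>C\<close> into an additive code whose
  symplectic dual is the image of the Hermitian dual, and Hamming weight into symplectic weight.
\<close>

text \<open>Stability of \<open>S\<close> holds because \<open>\<sigma>\<close> applied twice is
  multiplication by q^2, which preserves cyclotomic cosets. The choice of \<open>T\<close> inside
  the defining set of \<open>D\<close> and outside that of the dual places \<open>S\<close> both in
  the defining set of \<open>D\<close> and in its image under \<open>\<sigma>\<close>. Since
  \<open>D\<close> lies in its dual, the complement of that image consists of zeros of
  \<open>D\<close>, so the zeros of \<open>C\<close> and of its dual together are exactly those of
  \<open>D\<close>. The sizes q^(2(k+r)) of \<open>C\<close> and q^(2k) of \<open>D\<close> are the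
  ones required for K = q^(n-2k-r) and R = q^r, and the bound on \<open>r\<close> keeps
  \<open>C\<close> different from the dual of \<open>D\<close>, which selects the distance over the
  set difference.

  Two obstacles shape the rest. The roots of unity live in an algebraic closure, so a set of
  exponents must be shown to define a polynomial over the alphabet; invariance under Frobenius
  decides this. The alphabets of \<open>C\<close> and of the additive code are unrelated types known
  only by their orders, so the inclusion of the field with q elements in the field with q^2 elements
  has to be constructed.\<close>

no_notation fps_nth (infixl \<open>$\<close> 75)

section \<open>Finite fields\<close>

lemma prime_CHAR_finite: "normalization_semidom_class.prime CHAR('a::{finite,field})"
  by (intro prime_CHAR_semidom finite_imp_CHAR_pos) simp

lemma CHAR_eqI_CARD:
  assumes "normalization_semidom_class.prime p" "CARD('a::{finite,field}) = p ^ e"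
  shows "CHAR('a) = p"
proof -
  have "CHAR('a) dvd p ^ e" using CHAR_dvd_CARD[where ?'a = 'a] assms by simp
  then have "CHAR('a) dvd p"
    using prime_dvd_power[OF prime_CHAR_finite[where ?'a = 'a]] by blast
  then show ?thesis
    using assms(1) prime_CHAR_finite[where ?'a = 'a] primes_dvd_imp_eq by blast
qed

text \<open>Multiplication by a nonzero \<open>x\<close> permutes the nonzero elements, so the
  product of all \<open>x * y\<close> equals the product of all \<open>y\<close>, which is nonzero
  and cancels.\<close>

lemma power_CARD_eq_self: "x ^ CARD('a) = (x :: 'a::{finite,field})"
proof (cases "x = 0")
  case False
  have "x * (\<Prod>y\<in>UNIV-{0}. x * y) = x ^ Suc (CARD('a) - 1) * \<Prod>(UNIV-{0})"
    by (subst power_Suc) (auto simp: prod.distrib mult_ac)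
  also have "Suc (CARD('a) - 1) = CARD('a)"
    using finite_UNIV_card_ge_0[where ?'a = 'a] by simp
  also have "(\<Prod>y\<in>UNIV-{0}. x * y) = (\<Prod>y\<in>UNIV-{0}. y)"
    by (rule prod.reindex_bij_witness[of _ "\<lambda>y. y / x" "\<lambda>y. x * y"]) (use False in auto)
  finally show ?thesis
    by simp
qed simp

lemma CARD_field_gt_1: "CARD('a::{finite,field}) > 1"
proof -
  have "card {0, 1 :: 'a} \<le> CARD('a)"
    by (intro card_mono) auto
  then show ?thesis by simp
qed

text \<open>Used to choose elements: a point where a cofactor does not vanish in the field
  embedding, an element of nonzero trace, and the basis element \<open>\<beta>\<close>.\<close>

lemma ex_nonroot:
  fixes P :: "'a::{finite,field} poly"
  assumes "P \<noteq> 0" "Polynomial.degree P < CARD('a)"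
  shows "\<exists>x. poly P x \<noteq> 0"
proof (rule ccontr)
  assume "\<not> ?thesis"
  then have "{x. poly P x = 0} = UNIV" by auto
  then show False using card_poly_roots_bound[OF assms(1)] assms(2) by simp
qed

text \<open>Cyclicity of the multiplicative group, transported from a field given by a carrier and
  operations to the type itself.\<close>

lemma finite_field_generator:
  obtains g :: "'a::{finite,field}" where "\<And>x. x \<noteq> 0 \<Longrightarrow> \<exists>i. x = g ^ i"
proof -
  let ?R = "ring_of_type_algebra :: 'a ring"
  interpret F: field ?R by (rule field_from_type_algebra)
  have carr: "carrier ?R = UNIV" and zero: "\<zero>\<^bsub>?R\<^esub> = 0"
    by (simp_all add: ring_of_type_algebra_def)
  have pow: "x [^]\<^bsub>?R\<^esub> i = x ^ i" for x and i :: nat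
    by (induction i) (simp_all add: ring_of_type_algebra_def mult.commute)
  obtain g where "carrier (Multiplicative_Group.mult_of ?R) = {g [^]\<^bsub>?R\<^esub> i |i::nat. i \<in> UNIV}"
    using F.finite_field_mult_group_has_gen by (auto simp: carr)
  then have "UNIV - {0} = {g ^ i |i. i \<in> UNIV}"
    by (simp add: carr zero pow)
  then show ?thesis
    by (intro that[of g]) blast
qed

text \<open>A generator of the multiplicative group of \<open>'b\<close> is sent to a root, in \<open>'a\<close>, of an integer
  polynomial that represents its minimal polynomial; pseudo-division keeps all polynomials
  over the integers, which act on both fields.\<close>
lemma finite_field_embedding:
  assumes card: "CARD('a::{finite,field}) = CARD('b::{finite,field}) ^ k"
    and char: "CHAR('a) = CHAR('b)"
  shows "\<exists>\<iota> :: 'b \<Rightarrow> 'a. field_hom \<iota>"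
proof -
  interpret A: map_poly_comm_ring_hom "of_int :: int \<Rightarrow> 'a" ..
  interpret B: map_poly_comm_ring_hom "of_int :: int \<Rightarrow> 'b" ..
  \<comment> \<open>Equal characteristics are the bridge between the two types: an integer vanishes
    in one field exactly when it does in the other.\<close>
  have zero_iff: "of_int z = (0 :: 'a) \<longleftrightarrow> of_int z = (0 :: 'b)" for z
    by (simp add: of_int_eq_0_iff_char_dvd char)
  obtain \<gamma> :: 'b where \<gamma>: "\<And>x. x \<noteq> 0 \<Longrightarrow> \<exists>i. x = \<gamma> ^ i"
    using finite_field_generator by blast
  define evb where "evb f = poly (map_poly of_int f) \<gamma>" for f :: "int poly"
  define eva where "eva h f = poly (map_poly of_int f) h" for f :: "int poly" and h :: 'a
  have evb_simps: "evb (f + g) = evb f + evb g" "evb (f * g) = evb f * evb g"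
    "evb (f - g) = evb f - evb g" "evb 1 = 1" "evb 0 = 0"
    "evb (Polynomial.monom c i) = of_int c * \<gamma> ^ i" "evb (Polynomial.smult c f) = of_int c * evb f"
    for f g c i
    by (simp_all add: evb_def hom_distribs poly_monom)
  have eva_simps: "eva h (f + g) = eva h f + eva h g" "eva h (f * g) = eva h f * eva h g"
    "eva h (f - g) = eva h f - eva h g" "eva h 1 = 1" "eva h 0 = 0"
    "eva h (Polynomial.monom c i) = of_int c * h ^ i" "eva h (Polynomial.smult c f) = of_int c * eva h f"
    for h f g c i
    by (simp_all add: eva_def hom_distribs poly_monom)
  define Q where "Q = CARD('a)"
  have Q1: "Q > 1" using CARD_field_gt_1[where ?'a='a] by (simp add: Q_def)
  have powQ: "x ^ Q = x" for x :: 'b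
  proof -
    have "x ^ (CARD('b) ^ j) = x" for j
      by (induction j) (simp_all add: power_mult power_CARD_eq_self)
    then show ?thesis by (simp add: Q_def card)
  qed
  \<comment> \<open>x^Q - x vanishes at every point of both fields: on \<open>'a\<close> because
    \<open>Q\<close> is its order, on \<open>'b\<close> because \<open>Q\<close> is a power of the
    order of \<open>'b\<close>.\<close>
  define W where "W = Polynomial.monom 1 Q - Polynomial.monom (1::int) 1"
  have degW: "Polynomial.degree W = Q" "poly.coeff W Q = 1"
  proof -
    show c: "poly.coeff W Q = 1" using Q1 by (simp add: W_def)
    have "Polynomial.degree W \<le> Q"
      unfolding W_def using Q1 by (intro degree_diff_le) (auto simp: degree_monom_eq)
    moreover have "Q \<le> Polynomial.degree W" using c by (intro le_degree) simp
    ultimately show "Polynomial.degree W = Q" by simp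
  qed
  \<comment> \<open>Reduction can lower the degree of an integer polynomial, so the leading
    coefficient is required to survive in \<open>'b\<close>. A \<open>good\<close> polynomial of
    least degree then reduces to a scalar multiple of the minimal polynomial of
    \<open>\<gamma>\<close>.\<close>
  define good where "good m \<longleftrightarrow> evb m = 0 \<and> of_int (Polynomial.lead_coeff m) \<noteq> (0::'b)" for m
  have "evb W = 0" by (simp add: W_def evb_simps powQ)
  then have "good W"
    by (simp add: good_def degW)
  then obtain \<mu> where \<mu>: "good \<mu>" and least: "\<And>m. good m \<Longrightarrow> Polynomial.degree \<mu> \<le> Polynomial.degree m"
    using ex_has_least_nat[of good W Polynomial.degree] by blast
  define c where "c = Polynomial.lead_coeff \<mu>"
  have c: "of_int c \<noteq> (0::'b)" "of_int c \<noteq> (0::'a)"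
    using \<mu> by (auto simp: good_def c_def zero_iff)
  then have "\<mu> \<noteq> 0" by (auto simp: c_def)
  have deg_pos: "Polynomial.degree \<mu> > 0"
  proof (rule ccontr)
    assume "\<not> ?thesis"
    then have "\<mu> = Polynomial.monom c 0"
      by (auto simp: c_def monom_0 elim!: degree_eq_zeroE)
    then have "evb \<mu> = of_int c" by (simp add: evb_simps)
    with c \<mu> show False by (simp add: good_def)
  qed
  \<comment> \<open>By minimality of \<open>\<mu>\<close> the leading coefficient of such an
    \<open>r\<close> vanishes in \<open>'b\<close>, hence in \<open>'a\<close>; removing the leading
    term leaves a polynomial of the same kind.\<close>
  have small: "map_poly of_int r = (0 :: 'a poly)"
    if "evb r = 0" "r = 0 \<or> Polynomial.degree r < Polynomial.degree \<mu>" for r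
    using that
  proof (induction "Polynomial.degree r" arbitrary: r rule: less_induct)
    case less
    show ?case
    proof (cases "r = 0")
      case False
      define l where "l = Polynomial.lead_coeff r"
      define r' where "r' = r - Polynomial.monom l (Polynomial.degree r)"
      have "of_int l = (0::'b)"
        using least[of r] less.prems False by (auto simp: good_def l_def)
      then have "evb r' = 0" and l: "of_int l = (0::'a)"
        using less.prems by (auto simp: r'_def evb_simps zero_iff)
      have r'deg: "r' = 0 \<or> Polynomial.degree r' < Polynomial.degree r"
      proof (cases "Polynomial.degree r = 0")
        case True
        then show ?thesis
          by (auto simp: r'_def l_def monom_0 elim!: degree_eq_zeroE)
      next
        case False
        have "Polynomial.degree r' < Polynomial.degree r"
          by (rule degree_lessI) (use False in \<open>auto simp: r'_def l_def coeff_eq_0 le_less\<close>)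
        then show ?thesis ..
      qed
      have "map_poly of_int r' = (0 :: 'a poly)"
      proof (cases "r' = 0")
        case False
        then show ?thesis using less.hyps[of r'] \<open>evb r' = 0\<close> r'deg less.prems by auto
      qed simp
      then show ?thesis by (simp add: r'_def hom_distribs l)
    qed simp
  qed
  have division: "\<exists>s r e. Polynomial.smult (c ^ e) f = \<mu> * s + r \<and>
      (r = 0 \<or> Polynomial.degree r < Polynomial.degree \<mu>)" for f
    using pseudo_divmod[OF \<open>\<mu> \<noteq> 0\<close>, of f] unfolding c_def by (metis surj_pair)
  \<comment> \<open>Up to a nonzero scalar, \<open>W\<close> reduces to the product of
    \<open>\<mu>\<close> and \<open>s\<close>. The cofactor has degree below \<open>Q\<close>, so it
    is nonzero at some \<open>x\<close> in \<open>'a\<close>, where \<open>W\<close> vanishes; this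
    \<open>x\<close> is a root of \<open>\<mu>\<close>.\<close>
  obtain h where h: "eva h \<mu> = 0"
  proof -
    obtain s r e where sr: "Polynomial.smult (c ^ e) W = \<mu> * s + r"
        and r: "r = 0 \<or> Polynomial.degree r < Polynomial.degree \<mu>"
      using division by blast
    have "evb r = 0"
      using arg_cong[OF sr, of evb] \<mu> \<open>evb W = 0\<close> by (simp add: evb_simps good_def)
    then have "map_poly of_int r = (0 :: 'a poly)" by (intro small r)
    then have eq: "map_poly of_int \<mu> * map_poly of_int s =
        Polynomial.smult (of_int (c ^ e)) (map_poly of_int W :: 'a poly)"
      using arg_cong[OF sr, of "map_poly of_int :: _ \<Rightarrow> 'a poly"] by (simp add: hom_distribs)
    let ?W = "map_poly of_int W :: 'a poly" and ?\<mu> = "map_poly of_int \<mu> :: 'a poly"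
      and ?s = "map_poly of_int s :: 'a poly"
    have "Polynomial.degree ?W = Q"
      using degW by (subst degree_map_poly) auto
    moreover have "Polynomial.degree ?\<mu> = Polynomial.degree \<mu>"
      using c by (subst degree_map_poly) (auto simp: c_def)
    moreover have "?W \<noteq> 0" using \<open>Polynomial.degree ?W = Q\<close> Q1 by auto
    moreover from this have "?\<mu> * ?s \<noteq> 0" using eq c by auto
    moreover have "Polynomial.degree (?\<mu> * ?s) = Q"
      unfolding eq using \<open>Polynomial.degree ?W = Q\<close> c by simp
    ultimately have "Polynomial.degree ?s < Q" "?s \<noteq> 0"
      using deg_pos by (auto simp: degree_mult_eq)
    then obtain x where "poly ?s x \<noteq> 0" using ex_nonroot[of ?s] by (auto simp: Q_def)
    moreover have "poly (?\<mu> * ?s) x = 0"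
      unfolding eq by (simp add: W_def hom_distribs poly_monom Q_def power_CARD_eq_self)
    ultimately show ?thesis
      using that[of x] by (simp add: eva_def)
  qed
  \<comment> \<open>Integer relations satisfied by \<open>\<gamma>\<close> pass to \<open>h\<close>,
    so sending \<open>\<gamma>\<close> to \<open>h\<close> is well defined.\<close>
  have kernel: "eva h f = 0" if "evb f = 0" for f
  proof -
    obtain s r e where sr: "Polynomial.smult (c ^ e) f = \<mu> * s + r"
        and r: "r = 0 \<or> Polynomial.degree r < Polynomial.degree \<mu>"
      using division by blast
    have "evb r = 0"
      using arg_cong[OF sr, of evb] \<mu> that by (simp add: evb_simps good_def)
    then have "map_poly of_int r = (0 :: 'a poly)" by (intro small r)
    then have "eva h r = 0" by (simp add: eva_def)
    then show ?thesis
      using arg_cong[OF sr, of "eva h"] h c by (simp add: eva_simps)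
  qed
  have "\<exists>f. evb f = x" for x
  proof (cases "x = 0")
    case True
    then show ?thesis using evb_simps(5) by metis
  next
    case False
    then obtain i where "x = \<gamma> ^ i" using \<gamma> by blast
    then have "evb (Polynomial.monom 1 i) = x" by (simp add: evb_simps)
    then show ?thesis by blast
  qed
  then obtain F where F: "\<And>x. evb (F x) = x" by metis
  have eq: "eva h f = eva h g" if "evb f = evb g" for f g
    using kernel[of "f - g"] that by (simp add: eva_simps evb_simps)
  have "field_hom (\<lambda>x. eva h (F x))"
  proof
    show "eva h (F 1) = 1" using eq[of "F 1" 1] by (simp add: F evb_simps eva_simps)
    show "eva h (F 0) = 0" using eq[of "F 0" 0] by (simp add: F evb_simps eva_simps)
    show "eva h (F (x + y)) = eva h (F x) + eva h (F y)" for x y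
      using eq[of "F (x + y)" "F x + F y"] by (simp add: F evb_simps eva_simps)
    show "eva h (F (x * y)) = eva h (F x) * eva h (F y)" for x y
      using eq[of "F (x * y)" "F x * F y"] by (simp add: F evb_simps eva_simps)
  qed
  then show ?thesis by blast
qed

section \<open>Codes as zero sets\<close>

lemma card_carrier_vec: "card (carrier_vec n :: 'a::finite vec set) = CARD('a) ^ n"
proof -
  let ?L = "{xs :: 'a list. set xs \<subseteq> UNIV \<and> length xs = n}"
  have "inj_on vec_of_list ?L"
    by (rule inj_on_inverseI[of _ list_of_vec]) (rule list_vec)
  moreover have "vec_of_list ` ?L = carrier_vec n"
  proof (intro equalityI subsetI)
    fix v :: "'a vec" assume "v \<in> carrier_vec n"
    then show "v \<in> vec_of_list ` ?L"
      by (intro image_eqI[where x = "list_of_vec v"])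
        (simp_all only: vec_list mem_Collect_eq length_list_of_vec carrier_vecD subset_UNIV conj_ac simp_thms)
  next
    fix v :: "'a vec" assume "v \<in> vec_of_list ` ?L"
    then show "v \<in> carrier_vec n" by (auto intro: carrier_vecI)
  qed
  ultimately have "card (carrier_vec n :: 'a vec set) = card ?L"
    using card_image[of vec_of_list ?L] by simp
  then show ?thesis
    by (simp only: card_lists_length_eq[OF finite])
qed

section \<open>Products of linear factors\<close>

lemma prod_linear_dvd_iff:
  fixes f :: "'i \<Rightarrow> 'a::field"
  assumes "finite T" "inj_on f T"
  shows "(\<Prod>t\<in>T. [:- f t, 1:]) dvd p \<longleftrightarrow> (\<forall>t\<in>T. poly p (f t) = 0)"
  using assms
proof (induction T arbitrary: p)
  case (insert s T)
  show ?case
  proof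
    assume "(\<Prod>t\<in>insert s T. [:- f t, 1:]) dvd p"
    then obtain k where "p = (\<Prod>t\<in>insert s T. [:- f t, 1:]) * k" ..
    then show "\<forall>t\<in>insert s T. poly p (f t) = 0"
      using insert.hyps by (auto simp: poly_prod)
  next
    assume zeros: "\<forall>t\<in>insert s T. poly p (f t) = 0"
    then obtain k where k: "p = [:- f s, 1:] * k"
      by (auto simp: poly_eq_0_iff_dvd dvd_def)
    have "poly k (f t) = 0" if "t \<in> T" for t
    proof -
      have "f t \<noteq> f s" using that insert by (auto simp: inj_on_def)
      moreover have "poly p (f t) = 0" using that zeros by auto
      ultimately show ?thesis unfolding k by simp
    qed
    then have "(\<Prod>t\<in>T. [:- f t, 1:]) dvd k" using insert by auto
    then show "(\<Prod>t\<in>insert s T. [:- f t, 1:]) dvd p"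
      using insert.hyps by (simp add: k mult_dvd_mono del: mult_pCons_left)
  qed
qed simp

text \<open>Each linear factor divides either \<open>p\<close> or its cofactor and can be cancelled
  there, which reduces the claim to a smaller product.\<close>

lemma monic_dvd_prod_linear:
  fixes f :: "'i \<Rightarrow> 'a::field"
  assumes "finite T" "p dvd (\<Prod>t\<in>T. [:- f t, 1:])" "Polynomial.lead_coeff p = 1"
  shows "\<exists>S\<subseteq>T. p = (\<Prod>t\<in>S. [:- f t, 1:])"
  using assms
proof (induction T arbitrary: p)
  case empty
  then have "Polynomial.degree p = 0" by (auto simp: poly_dvd_1)
  then show ?case using empty by (auto elim!: degree_eq_zeroE)
next
  case (insert s T)
  define P where "P = (\<Prod>t\<in>T. [:- f t, 1:])"
  define L where "L = [:- f s, 1:]"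
  have L: "L \<noteq> 0" "Polynomial.lead_coeff L = 1" "\<And>r. poly r (f s) = 0 \<longleftrightarrow> L dvd r"
    by (simp_all add: L_def poly_eq_0_iff_dvd)
  have dvd: "p dvd L * P" using insert by (simp add: L_def P_def)
  show ?case
  proof (cases "poly p (f s) = 0")
    case True
    then obtain k where k: "p = L * k" using L(3) by (auto simp: dvd_def)
    then have "k dvd P" using dvd L(1) by simp
    moreover have "Polynomial.lead_coeff k = 1"
      using insert.prems(2) L(2) unfolding k by (simp add: lead_coeff_mult)
    ultimately obtain S where S: "S \<subseteq> T" "k = (\<Prod>t\<in>S. [:- f t, 1:])"
      using insert.IH unfolding P_def by blast
    then have "finite S" "s \<notin> S" using insert.hyps finite_subset by auto
    then have "p = (\<Prod>t\<in>insert s S. [:- f t, 1:])"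
      unfolding k S(2) L_def by (rule prod.insert[symmetric])
    then show ?thesis
      using \<open>S \<subseteq> T\<close> by (intro exI[of _ "insert s S"]) auto
  next
    case False
    obtain k where k: "L * P = p * k" using dvd by (auto simp: dvd_def)
    have "poly (L * P) (f s) = 0" by (simp add: L_def)
    then have "poly k (f s) = 0" unfolding k using False by simp
    then obtain l where "k = L * l" using L(3) by (auto simp: dvd_def)
    then have "L * P = L * (p * l)" unfolding k by (simp only: mult_ac)
    then have "p dvd P" using L(1) by simp
    then obtain S where "S \<subseteq> T" "p = (\<Prod>t\<in>S. [:- f t, 1:])"
      using insert.IH[of p] insert.prems(2) unfolding P_def by blast
    then show ?thesis by (intro exI[of _ S]) auto
  qed
qed

section \<open>Words as polynomials\<close>

lemma code_poly_coeff: "poly.coeff (code_poly c) i = (if i < dim_vec c then c $ i else 0)"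
  by (simp add: code_poly_def nth_default_def)

lemma code_poly_vec_coeff:
  assumes "\<And>i. n \<le> i \<Longrightarrow> poly.coeff p i = 0"
  shows "code_poly (vec n (poly.coeff p)) = p"
  by (rule poly_eqI) (use assms in \<open>auto simp: code_poly_coeff\<close>)

lemma inj_on_code_poly: "inj_on code_poly (carrier_vec n)"
proof (rule inj_onI)
  fix c d :: "'a vec"
  assume c: "c \<in> carrier_vec n" and d: "d \<in> carrier_vec n" and eq: "code_poly c = code_poly d"
  have "c $ i = d $ i" if "i < n" for i
    using code_poly_coeff[of c i] code_poly_coeff[of d i] c d that eq by simp
  then show "c = d" using c d by (intro eq_vecI) auto
qed

interpretation to_ac: field_hom to_ac
  by standard auto

interpretation to_ac_poly: map_poly_inj_idom_hom to_ac ..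

text \<open>At the powers of \<alpha> this is the discrete Fourier transform of the word. The
  explicit sum over positions is the form in which the correlation identity is computed.\<close>

definition code_eval :: "'a::field vec \<Rightarrow> 'a alg_closure \<Rightarrow> 'a alg_closure" where
  "code_eval c z = (\<Sum>i<dim_vec c. to_ac (c $ i) * z ^ i)"

lemma code_eval_poly: "code_eval c z = poly (map_poly to_ac (code_poly c)) z"
proof -
  define p where "p = map_poly to_ac (code_poly c)"
  have p: "poly.coeff p i = (if i < dim_vec c then to_ac (c $ i) else 0)" for i
    by (simp add: p_def code_poly_coeff)
  let ?A = "{..Polynomial.degree p} \<union> {..<dim_vec c}"
  have "poly p z = (\<Sum>i\<le>Polynomial.degree p. poly.coeff p i * z ^ i)"
    by (rule poly_altdef)
  also have "\<dots> = (\<Sum>i\<in>?A. poly.coeff p i * z ^ i)"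
    by (rule sum.mono_neutral_left) (auto simp: coeff_eq_0)
  also have "\<dots> = (\<Sum>i<dim_vec c. poly.coeff p i * z ^ i)"
    by (rule sum.mono_neutral_right) (auto simp: p)
  finally show ?thesis by (simp add: code_eval_def p flip: p_def)
qed

section \<open>Cyclic codes and their zeros\<close>

locale root_of_unity =
  fixes n :: nat and \<alpha> :: "'a::{finite,field} alg_closure"
  assumes n_pos: "n > 0"
    and primitive: "primitive_root_of_unity n \<alpha>"
    and primepow_CARD: "primepow CARD('a)"
begin

abbreviation modulus :: "'a poly" where "modulus \<equiv> Polynomial.monom 1 n - 1"

text \<open>The set \<open>T\<close> is arbitrary at this point; when it is the defining set of the
  code is a question of rationality, answered in \<open>is_defining_set_code_of\<close>.\<close>

definition code_of :: "nat set \<Rightarrow> 'a vec set" where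
  "code_of T = {c \<in> carrier_vec n. \<forall>t\<in>T. code_eval c (\<alpha> ^ t) = 0}"

lemma code_of_Un: "code_of (A \<union> B) = code_of A \<inter> code_of B"
  by (auto simp: code_of_def)

lemma \<alpha>_power_n: "\<alpha> ^ n = 1" and \<alpha>_power_neq_1: "0 < j \<Longrightarrow> j < n \<Longrightarrow> \<alpha> ^ j \<noteq> 1"
  using primitive by (auto simp: primitive_root_of_unity_def)

lemma \<alpha>_nonzero: "\<alpha> \<noteq> 0"
  using \<alpha>_power_n n_pos by (auto simp: power_0_left)

lemma \<alpha>_power_mod: "\<alpha> ^ (i mod n) = \<alpha> ^ i"
proof -
  have "\<alpha> ^ i = \<alpha> ^ (n * (i div n) + i mod n)" by simp
  also have "\<dots> = \<alpha> ^ (i mod n)" by (simp only: power_add power_mult \<alpha>_power_n) simp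
  finally show ?thesis ..
qed

lemma inj_\<alpha>_power: "inj_on (\<lambda>t. \<alpha> ^ t) {..<n}"
proof -
  have "s = t" if "s \<le> t" "t < n" "\<alpha> ^ s = \<alpha> ^ t" for s t
  proof (rule ccontr)
    assume "s \<noteq> t"
    have "\<alpha> ^ t = \<alpha> ^ s * \<alpha> ^ (t - s)" using that(1) by (simp only: power_add[symmetric]) simp
    then have "\<alpha> ^ (t - s) = 1" using that \<alpha>_nonzero by simp
    then show False using \<alpha>_power_neq_1[of "t - s"] that \<open>s \<noteq> t\<close> by simp
  qed
  then show ?thesis
    by (intro inj_onI) (metis lessThan_iff nle_le)
qed

lemma degree_modulus: "Polynomial.degree modulus = n" and lead_coeff_modulus: "Polynomial.lead_coeff modulus = 1"
proof -
  have c: "poly.coeff modulus n = 1" using n_pos by simp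
  have "Polynomial.degree modulus \<le> n"
    by (intro degree_diff_le) (auto simp: degree_monom_eq)
  moreover have "n \<le> Polynomial.degree modulus" using c by (intro le_degree) simp
  ultimately show "Polynomial.degree modulus = n" by simp
  with c show "Polynomial.lead_coeff modulus = 1" by simp
qed

text \<open>Both sides have degree at most \<open>n\<close>, the same coefficient at
  \<open>n\<close>, and vanish at the \<open>n\<close> distinct powers of \<alpha>; this determines
  the polynomial.\<close>

lemma map_modulus_eq_prod: "map_poly to_ac modulus = (\<Prod>t<n. [:- (\<alpha> ^ t), 1:])"
proof (rule poly_eqI_degree_lead_coeff[where A = "(\<lambda>t. \<alpha> ^ t) ` {..<n}" and n = n])
  have deg: "Polynomial.degree (\<Prod>t<n. [:- (\<alpha> ^ t), 1:]) = n"
    by (subst degree_prod_eq_sum_degree) auto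
  then show "Polynomial.degree (\<Prod>t<n. [:- (\<alpha> ^ t), 1:]) \<le> n" by simp
  have "Polynomial.lead_coeff (\<Prod>t<n. [:- (\<alpha> ^ t), 1:]) = 1"
    by (simp add: lead_coeff_prod)
  then have "poly.coeff (\<Prod>t<n. [:- (\<alpha> ^ t), 1:]) n = 1"
    unfolding deg .
  then show "poly.coeff (map_poly to_ac modulus) n = poly.coeff (\<Prod>t<n. [:- (\<alpha> ^ t), 1:]) n"
    using n_pos by simp
  show "n \<le> card ((\<lambda>t. \<alpha> ^ t) ` {..<n})"
    by (simp add: card_image inj_\<alpha>_power)
  show "Polynomial.degree (map_poly to_ac modulus) \<le> n"
    using degree_modulus by (simp del: to_ac_poly.hom_minus)
  fix z assume "z \<in> (\<lambda>t. \<alpha> ^ t) ` {..<n}"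
  then obtain t where t: "t < n" "z = \<alpha> ^ t" by auto
  then have "z ^ n = 1"
    by (metis \<alpha>_power_n mult.commute power_mult power_one)
  then have "poly (map_poly to_ac modulus) z = 0"
    by (simp add: hom_distribs poly_monom)
  moreover have "poly (\<Prod>t<n. [:- (\<alpha> ^ t), 1:]) z = 0"
    using t by (auto simp: poly_prod)
  ultimately show "poly (map_poly to_ac modulus) z = poly (\<Prod>t<n. [:- (\<alpha> ^ t), 1:]) z" by simp
qed

lemma degree_code_poly: "c \<in> carrier_vec n \<Longrightarrow> Polynomial.degree (code_poly c) < n"
  by (rule degree_lessI) (use n_pos in \<open>auto simp: code_poly_coeff\<close>)

lemma cong_mult_generator_iff:
  assumes "g dvd modulus"
  shows "(\<exists>a. [p = a * g] (mod modulus)) \<longleftrightarrow> g dvd p"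
proof
  assume "\<exists>a. [p = a * g] (mod modulus)"
  then obtain a where "[p = a * g] (mod modulus)" ..
  then show "g dvd p" using assms by (metis cong_dvd_iff cong_dvd_modulus dvd_triv_right)
next
  assume "g dvd p"
  then show "\<exists>a. [p = a * g] (mod modulus)" by (metis cong_refl dvd_def mult.commute)
qed

text \<open>Divisibility by \<open>g\<close> can be tested over the closure, where \<open>g\<close>
  splits into distinct linear factors.\<close>

lemma generated_code_eq:
  assumes "g dvd modulus" "map_poly to_ac g = (\<Prod>t\<in>T. [:- (\<alpha> ^ t), 1:])" "T \<subseteq> {..<n}"
  shows "{c \<in> carrier_vec n. \<exists>a. [code_poly c = a * g] (mod modulus)} = code_of T"
proof -
  have "g dvd code_poly c \<longleftrightarrow> (\<forall>t\<in>T. code_eval c (\<alpha> ^ t) = 0)" for c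
  proof -
    have "finite T" "inj_on (\<lambda>t. \<alpha> ^ t) T"
      using assms(3) inj_\<alpha>_power by (auto intro: finite_subset inj_on_subset)
    then have "map_poly to_ac g dvd map_poly to_ac (code_poly c) \<longleftrightarrow> (\<forall>t\<in>T. code_eval c (\<alpha> ^ t) = 0)"
      unfolding assms(2) code_eval_poly by (rule prod_linear_dvd_iff)
    moreover have "map_poly to_ac g dvd map_poly to_ac (code_poly c) \<longleftrightarrow> g dvd code_poly c"
      using to_ac.dvd_map_poly_hom_imp_dvd to_ac_poly.hom_dvd by blast
    ultimately show ?thesis by simp
  qed
  then show ?thesis
    using cong_mult_generator_iff[OF assms(1)] by (auto simp: code_of_def)
qed

lemma is_defining_set_code: "is_defining_set \<alpha> n C T \<Longrightarrow> C = code_of T"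
  using generated_code_eq by (auto simp: is_defining_set_def is_generator_poly_def)

lemma degree_generator:
  assumes "map_poly to_ac g = (\<Prod>t\<in>T. [:- (\<alpha> ^ t), 1:])"
  shows "Polynomial.degree (g :: 'a poly) = card T"
proof -
  have "Polynomial.degree (map_poly to_ac g) = card T"
    unfolding assms by (cases "finite T") (simp_all add: degree_prod_eq_sum_degree)
  then show ?thesis by simp
qed

text \<open>If \<open>T\<close> is proper, \<open>g\<close> has degree below \<open>n\<close> and is
  itself a codeword, and its zeros among the powers of \<alpha> are exactly those indexed by
  \<open>T\<close>. This makes the definite description in \<open>defining_set\<close>
  meaningful.\<close>

lemma defining_set_unique:
  assumes "is_defining_set \<alpha> n C T"
  shows "T = {t. t < n \<and> (\<forall>c\<in>C. code_eval c (\<alpha> ^ t) = 0)}"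
proof
  from assms have T: "T \<subseteq> {..<n}" by (simp add: is_defining_set_def)
  then show "T \<subseteq> {t. t < n \<and> (\<forall>c\<in>C. code_eval c (\<alpha> ^ t) = 0)}"
    using is_defining_set_code[OF assms] by (auto simp: code_of_def)
  show "{t. t < n \<and> (\<forall>c\<in>C. code_eval c (\<alpha> ^ t) = 0)} \<subseteq> T"
  proof (rule ccontr)
    assume "\<not> ?thesis"
    then obtain t where t: "t < n" "t \<notin> T" "\<And>c. c \<in> C \<Longrightarrow> code_eval c (\<alpha> ^ t) = 0" by auto
    from assms obtain g where g: "is_generator_poly n C g"
      and map_g: "map_poly to_ac g = (\<Prod>t\<in>T. [:- (\<alpha> ^ t), 1:])"
      by (auto simp: is_defining_set_def)
    have "T \<subset> {..<n}" using T t by auto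
    then have "card T < n" using psubset_card_mono[of "{..<n}" T] by simp
    then have eq: "code_poly (vec n (poly.coeff g)) = g"
      using degree_generator[OF map_g] by (intro code_poly_vec_coeff) (simp add: coeff_eq_0)
    then have "vec n (poly.coeff g) \<in> C"
      using g by (auto simp: is_generator_poly_def intro!: exI[of _ 1])
    then have "poly (map_poly to_ac g) (\<alpha> ^ t) = 0"
      using t(3) eq by (metis code_eval_poly)
    then obtain s where "s \<in> T" "\<alpha> ^ s = \<alpha> ^ t"
      using T finite_subset[OF T] by (auto simp: map_g poly_prod)
    then show False using inj_onD[OF inj_\<alpha>_power, of s t] T t by auto
  qed
qed

lemma defining_set_eqI: "is_defining_set \<alpha> n C T \<Longrightarrow> defining_set \<alpha> n C = T"
  unfolding defining_set_def
proof (rule the_equality)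
  show "S = T" if "is_defining_set \<alpha> n C T" "is_defining_set \<alpha> n C S" for S
    using that[THEN defining_set_unique] by simp
qed

text \<open>Multiplication by \<open>g\<close> maps the polynomials of degree below
  \<open>n - card T\<close> bijectively onto the code; the products have degree below
  \<open>n\<close>, so no reduction modulo x^n - 1 intervenes.\<close>

lemma card_code:
  assumes "is_defining_set \<alpha> n C T"
  shows "card C = CARD('a) ^ (n - card T)"
proof -
  from assms obtain g where g: "is_generator_poly n C g" and T: "T \<subseteq> {..<n}"
    and map_g: "map_poly to_ac g = (\<Prod>t\<in>T. [:- (\<alpha> ^ t), 1:])"
    by (auto simp: is_defining_set_def)
  define d where "d = card T"
  have deg: "Polynomial.degree g = d" unfolding d_def by (rule degree_generator[OF map_g])
  have "d \<le> n" using T card_mono[of "{..<n}" T] by (simp add: d_def)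
  from g have "g dvd modulus" "g \<noteq> 0" by (auto simp: is_generator_poly_def)
  then have C: "C = {c \<in> carrier_vec n. g dvd code_poly c}"
    using g cong_mult_generator_iff by (auto simp: is_generator_poly_def)
  have mult: "code_poly (vec n (poly.coeff (code_poly v * g))) = code_poly v * g"
    if "v \<in> carrier_vec (n - d)" for v
  proof (rule code_poly_vec_coeff)
    fix i assume i: "n \<le> i"
    show "poly.coeff (code_poly v * g) i = 0"
    proof (cases "code_poly v = 0")
      case False
      then have "Polynomial.degree (code_poly v) < n - d"
        using that by (intro degree_lessI) (auto simp: code_poly_coeff)
      then show ?thesis
        using i deg degree_mult_le[of "code_poly v" g] by (intro coeff_eq_0) linarith
    qed simp
  qed
  have "bij_betw (\<lambda>v. vec n (poly.coeff (code_poly v * g))) (carrier_vec (n - d)) C"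
  proof (intro bij_betw_imageI inj_onI)
    fix v w
    assume v: "v \<in> carrier_vec (n - d)" and w: "w \<in> carrier_vec (n - d)"
      and eq: "vec n (poly.coeff (code_poly v * g)) = vec n (poly.coeff (code_poly w * g))"
    then have "code_poly v * g = code_poly w * g" using mult by metis
    then have "code_poly v = code_poly w" using \<open>g \<noteq> 0\<close> by simp
    then show "v = w" using inj_onD[OF inj_on_code_poly] v w by blast
  next
    show "(\<lambda>v. vec n (poly.coeff (code_poly v * g))) ` carrier_vec (n - d) = C"
    proof (intro equalityI subsetI)
      fix c assume "c \<in> (\<lambda>v. vec n (poly.coeff (code_poly v * g))) ` carrier_vec (n - d)"
      then show "c \<in> C" using mult by (auto simp: C)
    next
      fix c assume "c \<in> C"
      then have c: "c \<in> carrier_vec n" and "g dvd code_poly c" by (auto simp: C)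
      then obtain a where a: "code_poly c = a * g" by (metis dvd_def mult.commute)
      have "poly.coeff a i = 0" if i: "n - d \<le> i" for i
      proof (cases "a = 0")
        case False
        then have "Polynomial.degree a + d < n"
          using degree_code_poly[OF c] a deg \<open>g \<noteq> 0\<close> by (simp add: degree_mult_eq)
        then show ?thesis using i by (intro coeff_eq_0) linarith
      qed simp
      then have *: "code_poly (vec (n - d) (poly.coeff a)) = a" by (rule code_poly_vec_coeff)
      have "vec n (poly.coeff (a * g)) = c"
        using c unfolding a[symmetric] by (auto simp: code_poly_coeff)
      then show "c \<in> (\<lambda>v. vec n (poly.coeff (code_poly v * g))) ` carrier_vec (n - d)"
        using * by (intro image_eqI[of _ _ "vec (n - d) (poly.coeff a)"]) auto
    qed
  qed
  from bij_betw_same_card[OF this] show ?thesis by (simp add: card_carrier_vec d_def)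
qed

section \<open>Cyclic codes as ideals: existence of the generator polynomial\<close>

lemma cyclic_shift_poly:
  assumes "c \<in> carrier_vec n"
  shows "pCons 0 (code_poly c) = code_poly (cyclic_shift n c) + Polynomial.smult (c $ (n - 1)) modulus"
proof (rule poly_eqI)
  fix i
  show "poly.coeff (pCons 0 (code_poly c)) i =
      poly.coeff (code_poly (cyclic_shift n c) + Polynomial.smult (c $ (n - 1)) modulus) i"
  proof (cases i)
    case 0
    then show ?thesis
      using assms n_pos by (simp add: code_poly_coeff cyclic_shift_def)
  next
    case (Suc j)
    have dim: "dim_vec c = n" using assms by simp
    consider "Suc j < n" | "n = Suc j" | "n < Suc j" by linarith
    then show ?thesis
    proof cases
      case 1
      then have "(j + n) mod n = j" by simp
      then show ?thesis using 1 by (simp add: Suc dim code_poly_coeff cyclic_shift_def)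
    qed (simp_all add: Suc dim code_poly_coeff cyclic_shift_def)
  qed
qed

lemma cong_code_poly_imp_eq:
  assumes c: "c \<in> carrier_vec n" and d: "d \<in> carrier_vec n"
    and cong: "[code_poly c = code_poly d] (mod modulus)"
  shows "c = d"
proof -
  have "code_poly c mod modulus = code_poly c" "code_poly d mod modulus = code_poly d"
    using degree_code_poly[OF c] degree_code_poly[OF d] degree_modulus by (simp_all add: mod_poly_less)
  then have "code_poly c = code_poly d" using cong by (simp add: Cong.cong_def)
  then show ?thesis using inj_onD[OF inj_on_code_poly] c d by blast
qed

lemma code_poly_add:
  "c \<in> carrier_vec n \<Longrightarrow> d \<in> carrier_vec n \<Longrightarrow> code_poly (c + d) = code_poly c + code_poly d"
  by (rule poly_eqI) (auto simp: code_poly_coeff)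

lemma code_poly_smult: "c \<in> carrier_vec n \<Longrightarrow> code_poly (a \<cdot>\<^sub>v c) = Polynomial.smult a (code_poly c)"
  by (rule poly_eqI) (auto simp: code_poly_coeff)

text \<open>The preimage \<open>I\<close> of the code in the polynomial ring is an ideal containing
  the modulus. A monic element of least degree generates it by division with remainder, and in
  particular divides the modulus.\<close>

lemma cyclic_code_generator:
  fixes C :: "'a vec set"
  assumes "cyclic_code n C"
  shows "\<exists>g. is_generator_poly n C g"
proof -
  have carr: "c \<in> carrier_vec n" if "c \<in> C" for c
    using assms that by (auto simp: cyclic_code_def linear_code_def)
  define I where "I = {f. \<exists>c\<in>C. [code_poly c = f] (mod modulus)}"
  have I_add: "f + h \<in> I" if f: "f \<in> I" and h: "h \<in> I" for f h
  proof -
    from f h obtain c d where "c \<in> C" "d \<in> C" "[code_poly c = f] (mod modulus)" "[code_poly d = h] (mod modulus)"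
      by (auto simp: I_def)
    then have "c + d \<in> C" "[code_poly (c + d) = f + h] (mod modulus)"
      using assms carr by (auto simp: cyclic_code_def linear_code_def code_poly_add intro: cong_add)
    then show ?thesis by (auto simp: I_def)
  qed
  have I_smult: "Polynomial.smult a f \<in> I" if f: "f \<in> I" for a f
  proof -
    from f obtain c where c: "c \<in> C" "[code_poly c = f] (mod modulus)"
      by (auto simp: I_def)
    then have "a \<cdot>\<^sub>v c \<in> C" using assms by (auto simp: cyclic_code_def linear_code_def)
    moreover have "[[:a:] * code_poly c = [:a:] * f] (mod modulus)"
      using c(2) by (rule cong_scalar_left)
    ultimately show ?thesis using c carr by (auto simp: I_def code_poly_smult intro!: bexI[of _ "a \<cdot>\<^sub>v c"])
  qed
  have I_shift: "pCons 0 f \<in> I" if f: "f \<in> I" for f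
  proof -
    from f obtain c where c: "c \<in> C" "[code_poly c = f] (mod modulus)"
      by (auto simp: I_def)
    then have C: "cyclic_shift n c \<in> C" using assms by (auto simp: cyclic_code_def)
    have "[[:0, 1:] * code_poly c = [:0, 1:] * f] (mod modulus)"
      using c(2) by (rule cong_scalar_left)
    then have "[code_poly (cyclic_shift n c) + Polynomial.smult (c $ (n - 1)) modulus = pCons 0 f] (mod modulus)"
      unfolding cyclic_shift_poly[OF carr[OF c(1)], symmetric] by simp
    moreover have "[code_poly (cyclic_shift n c) + Polynomial.smult (c $ (n - 1)) modulus =
        code_poly (cyclic_shift n c)] (mod modulus)"
      unfolding cong_iff_dvd_diff by (simp add: dvd_smult)
    ultimately have "[code_poly (cyclic_shift n c) = pCons 0 f] (mod modulus)"
      using cong_sym cong_trans by blast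
    then show ?thesis using C by (auto simp: I_def)
  qed
  have zero: "0\<^sub>v n \<in> C" using assms by (auto simp: cyclic_code_def linear_code_def)
  have code_poly_zero: "code_poly (0\<^sub>v n) = (0 :: 'a poly)"
    by (rule poly_eqI) (simp add: code_poly_coeff)
  \<comment> \<open>Closure under scalars and under multiplication by x suffices, by induction on
    the coefficients of \<open>p\<close>.\<close>
  have I_mult: "p * f \<in> I" if "f \<in> I" for p f
  proof (induction p)
    case 0
    show ?case using zero code_poly_zero by (auto simp: I_def intro!: bexI[of _ "0\<^sub>v n"])
  next
    case (pCons a p)
    then show ?case using that I_add I_smult I_shift by (simp add: mult_pCons_left)
  qed
  have modI: "modulus \<in> I"
    using zero code_poly_zero by (auto simp: I_def Cong.cong_def intro!: bexI[of _ "0\<^sub>v n"])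
  define monic_in where "monic_in g \<longleftrightarrow> g \<in> I \<and> Polynomial.lead_coeff g = 1" for g
  have "monic_in modulus" using modI lead_coeff_modulus by (simp add: monic_in_def)
  then obtain g where g: "monic_in g"
      and least: "\<And>h. monic_in h \<Longrightarrow> Polynomial.degree g \<le> Polynomial.degree h"
    using ex_has_least_nat[of monic_in modulus Polynomial.degree] by blast
  then have gI: "g \<in> I" and lc: "Polynomial.lead_coeff g = 1" and "g \<noteq> 0" by (auto simp: monic_in_def)
  have dvd: "g dvd f" if f: "f \<in> I" for f
  proof (rule ccontr)
    assume "\<not> g dvd f"
    define r where "r = f mod g"
    have "r \<noteq> 0" using \<open>\<not> g dvd f\<close> by (simp add: r_def mod_eq_0_iff_dvd)
    have "r = f + (- (f div g)) * g" by (simp add: r_def minus_div_mult_eq_mod[symmetric])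
    then have "r \<in> I" using I_add[OF f I_mult[OF gI]] by metis
    then have "monic_in (Polynomial.smult (inverse (Polynomial.lead_coeff r)) r)"
      using I_smult \<open>r \<noteq> 0\<close> by (auto simp: monic_in_def)
    from least[OF this] have "Polynomial.degree g \<le> Polynomial.degree r" using \<open>r \<noteq> 0\<close> by simp
    moreover have "Polynomial.degree r < Polynomial.degree g"
      using degree_mod_less[OF \<open>g \<noteq> 0\<close>, of f] \<open>r \<noteq> 0\<close> by (simp add: r_def)
    ultimately show False by simp
  qed
  have "C = {c \<in> carrier_vec n. g dvd code_poly c}"
  proof (intro equalityI subsetI)
    fix c assume "c \<in> C"
    moreover from this have "code_poly c \<in> I" unfolding I_def using cong_refl by blast
    ultimately show "c \<in> {c \<in> carrier_vec n. g dvd code_poly c}" using carr dvd by simp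
  next
    fix c assume "c \<in> {c \<in> carrier_vec n. g dvd code_poly c}"
    then have c: "c \<in> carrier_vec n" and "g dvd code_poly c" by auto
    then have "code_poly c \<in> I" using I_mult[OF gI] by (metis dvd_def mult.commute)
    then obtain d where "d \<in> C" "[code_poly d = code_poly c] (mod modulus)" by (auto simp: I_def)
    then show "c \<in> C" using cong_code_poly_imp_eq[of d c] c carr by auto
  qed
  then have "is_generator_poly n C g"
    using lc dvd[OF modI] cong_mult_generator_iff[OF dvd[OF modI]] by (simp add: is_generator_poly_def)
  then show ?thesis ..
qed

text \<open>The generator divides x^n - 1, so over the closure it is the product over a subset of
  the linear factors of x^n - 1.\<close>

lemma is_defining_set_defining_set:
  assumes "cyclic_code n C"
  shows "is_defining_set \<alpha> n C (defining_set \<alpha> n C)"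
proof -
  obtain g where g: "is_generator_poly n C g" using cyclic_code_generator[OF assms] ..
  then have "map_poly to_ac g dvd map_poly to_ac modulus" "Polynomial.lead_coeff (map_poly to_ac g) = 1"
    using to_ac_poly.hom_dvd[of g modulus] unfolding to_ac.hom_lead_coeff
    by (simp_all only: is_generator_poly_def to_ac_1)
  then obtain S where "S \<subseteq> {..<n}" "map_poly to_ac g = (\<Prod>t\<in>S. [:- (\<alpha> ^ t), 1:])"
    unfolding map_modulus_eq_prod using monic_dvd_prod_linear[of "{..<n}"] by blast
  then have "is_defining_set \<alpha> n C S"
    using g by (auto simp: is_defining_set_def)
  then show ?thesis using defining_set_eqI by metis
qed

lemma cyclic_code_eq_code_of: "cyclic_code n C \<Longrightarrow> C = code_of (defining_set \<alpha> n C)"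
  by (rule is_defining_set_code[OF is_defining_set_defining_set])

lemma mem_defining_set_iff:
  "cyclic_code n C \<Longrightarrow> t \<in> defining_set \<alpha> n C \<longleftrightarrow> t < n \<and> (\<forall>c\<in>C. code_eval c (\<alpha> ^ t) = 0)"
  using defining_set_unique[OF is_defining_set_defining_set] by blast

section \<open>Frobenius and descent from the closure to the alphabet\<close>

lemma CARD_eq_power_CHAR: "\<exists>e. CARD('a) = CHAR('a) ^ e"
  using primepow_CARD CHAR_eqI_CARD[where ?'a = 'a] unfolding primepow_def by metis

lemma frobenius_sum: "(\<Sum>i\<in>A. f i) ^ CARD('a) = (\<Sum>i\<in>A. (f i :: 'a alg_closure) ^ CARD('a))"
proof -
  obtain e where "CARD('a) = CHAR('a) ^ e" using CARD_eq_power_CHAR ..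
  then show ?thesis using prime_CHAR_finite[where ?'a = 'a] by (intro freshmans_dream_sum') auto
qed

lemma frobenius_hom: "comm_ring_hom (\<lambda>x :: 'a alg_closure. x ^ CARD('a))"
proof -
  obtain e where e: "CARD('a) = CHAR('a) ^ e" using CARD_eq_power_CHAR ..
  show ?thesis
  proof
    show "(x + y) ^ CARD('a) = x ^ CARD('a) + y ^ CARD('a)" for x y :: "'a alg_closure"
      using e prime_CHAR_finite[where ?'a = 'a] by (intro freshmans_dream') auto
  qed (simp_all add: power_mult_distrib power_0_left)
qed

text \<open>Frobenius fixes the letters and is additive, so it acts only on the evaluation point.
  Zero sets of words are therefore stable under multiplication of exponents by
  \<open>CARD('a)\<close>.\<close>

lemma code_eval_frobenius:
  fixes c :: "'a vec"
  shows "code_eval c (z ^ CARD('a)) = code_eval c z ^ CARD('a)"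
proof -
  have "(to_ac (c $ i) * z ^ i) ^ CARD('a) = to_ac (c $ i) * (z ^ CARD('a)) ^ i" for i
  proof -
    have "to_ac (c $ i) ^ CARD('a) = to_ac (c $ i)"
      by (simp only: power_CARD_eq_self flip: to_ac_power)
    moreover have "(z ^ i) ^ CARD('a) = (z ^ CARD('a)) ^ i"
      by (simp only: power_mult[symmetric] mult.commute)
    ultimately show ?thesis by (simp only: power_mult_distrib)
  qed
  then show ?thesis by (simp only: code_eval_def frobenius_sum)
qed

text \<open>The fixed points are the roots of x^Q - x with \<open>Q = CARD('a)\<close>; there are at
  most \<open>Q\<close> of them, and the embedded alphabet already supplies that many.\<close>

lemma frobenius_fixed_in_range:
  assumes "z ^ CARD('a) = z"
  shows "z \<in> range (to_ac :: 'a \<Rightarrow> _)"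
proof -
  define P where "P = Polynomial.monom (1 :: 'a alg_closure) CARD('a) - Polynomial.monom 1 1"
  have "CARD('a) > 1" by (rule CARD_field_gt_1)
  have "poly.coeff P CARD('a) = 1" using \<open>CARD('a) > 1\<close> by (simp add: P_def)
  then have "P \<noteq> 0" by auto
  have "Polynomial.degree P \<le> CARD('a)"
    unfolding P_def using \<open>CARD('a) > 1\<close> by (intro degree_diff_le) (auto simp: degree_monom_eq)
  then have "card {x. poly P x = 0} \<le> card (range (to_ac :: 'a \<Rightarrow> _))"
    using card_poly_roots_bound[OF \<open>P \<noteq> 0\<close>] by (simp add: card_image inj_to_ac)
  moreover have "poly P (to_ac x) = 0" for x
    by (simp add: P_def poly_monom power_CARD_eq_self flip: to_ac_power)
  ultimately have "range to_ac = {x. poly P x = 0}"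
    using poly_roots_finite[OF \<open>P \<noteq> 0\<close>] by (intro card_seteq) auto
  then show ?thesis using assms by (auto simp: P_def poly_monom)
qed

lemma mod_CARD_mem_defining_set_iff:
  assumes "cyclic_code n C" "t < n"
  shows "t * CARD('a) mod n \<in> defining_set \<alpha> n C \<longleftrightarrow> t \<in> defining_set \<alpha> n C"
  using assms n_pos
  by (simp add: mem_defining_set_iff \<alpha>_power_mod power_mult code_eval_frobenius)

text \<open>Frobenius permutes the roots of \<open>G\<close>, hence fixes its coefficients, so
  \<open>G\<close> comes from a polynomial over the alphabet.\<close>

lemma is_defining_set_code_of:
  assumes T: "T \<subseteq> {..<n}" and closed: "\<And>t. t \<in> T \<Longrightarrow> t * CARD('a) mod n \<in> T"
  shows "is_defining_set \<alpha> n (code_of T) T"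
proof -
  interpret F: map_poly_comm_ring_hom "\<lambda>x :: 'a alg_closure. x ^ CARD('a)"
    by (intro map_poly_comm_ring_hom.intro frobenius_hom)
  interpret h: map_poly_comm_ring_hom "to_ac :: 'a \<Rightarrow> _" ..
  define G where "G = (\<Prod>t\<in>T. [:- (\<alpha> ^ t), 1:])"
  have "finite T" using T finite_subset by auto
  let ?f = "\<lambda>t. t * CARD('a) mod n"
  \<comment> \<open>Injectivity of Frobenius on the roots gives injectivity on the exponents; on a
    finite set stable under the map this yields a permutation.\<close>
  have "inj_on ?f T"
  proof (rule inj_onI)
    fix s t assume st: "s \<in> T" "t \<in> T" "?f s = ?f t"
    then have "(\<alpha> ^ s) ^ CARD('a) = (\<alpha> ^ t) ^ CARD('a)"
      by (metis \<alpha>_power_mod power_mult)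
    then have "(\<alpha> ^ s - \<alpha> ^ t) ^ CARD('a) = 0"
      by (simp add: F.base.hom_minus)
    then have "\<alpha> ^ s = \<alpha> ^ t" by simp
    then show "s = t" using st T inj_onD[OF inj_\<alpha>_power] by blast
  qed
  moreover have "?f ` T \<subseteq> T" using closed by auto
  ultimately have bij: "bij_betw ?f T T"
    using endo_inj_surj[OF \<open>finite T\<close>, of ?f] by (simp add: bij_betw_def)
  have "map_poly (\<lambda>x. x ^ CARD('a)) G = (\<Prod>t\<in>T. [:- (\<alpha> ^ ?f t), 1:])"
    by (simp add: G_def F.hom_prod F.base.hom_uminus F.base.map_poly_pCons_hom \<alpha>_power_mod power_mult)
  also have "\<dots> = G"
    unfolding G_def using bij by (rule prod.reindex_bij_betw)
  finally have "poly.coeff G i ^ CARD('a) = poly.coeff G i" for i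
    by (metis F.base.coeff_map_poly_hom)
  then have range: "poly.coeff G i \<in> range (to_ac :: 'a \<Rightarrow> _)" for i
    by (rule frobenius_fixed_in_range)
  define g where "g = map_poly of_ac G"
  have map_g: "map_poly to_ac g = G"
    by (rule poly_eqI) (simp add: g_def coeff_map_poly to_ac_of_ac[OF range])
  have "G dvd map_poly to_ac modulus"
    unfolding G_def map_modulus_eq_prod using T by (intro prod_dvd_prod_subset) auto
  then have "g dvd modulus"
    unfolding map_g[symmetric] by (rule to_ac.dvd_map_poly_hom_imp_dvd)
  moreover have "to_ac (Polynomial.lead_coeff g) = 1"
    unfolding to_ac.hom_lead_coeff[symmetric] map_g by (simp add: G_def lead_coeff_prod)
  ultimately have "is_generator_poly n (code_of T) g"
    using generated_code_eq[of g T] map_g T by (simp add: is_generator_poly_def G_def)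
  then show ?thesis using T map_g by (auto simp: is_defining_set_def G_def)
qed

lemma code_eval_add:
  "c \<in> carrier_vec n \<Longrightarrow> d \<in> carrier_vec n \<Longrightarrow> code_eval (c + d) z = code_eval c z + code_eval d z"
  by (simp add: code_eval_def algebra_simps sum.distrib)

lemma code_eval_smult: "code_eval (a \<cdot>\<^sub>v c) z = to_ac a * code_eval c z"
  by (simp add: code_eval_def algebra_simps sum_distrib_left)

lemma code_eval_cyclic_shift:
  fixes c :: "'a vec"
  assumes "c \<in> carrier_vec n" "z ^ n = 1"
  shows "code_eval (cyclic_shift n c) z = z * code_eval c z"
proof -
  interpret h: map_poly_comm_ring_hom "to_ac :: 'a \<Rightarrow> _" ..
  have "poly (map_poly to_ac (pCons 0 (code_poly c))) z =
      poly (map_poly to_ac (code_poly (cyclic_shift n c) + Polynomial.smult (c $ (n - 1)) modulus)) z"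
    by (simp only: cyclic_shift_poly[OF assms(1)])
  then show ?thesis
    by (simp add: code_eval_poly hom_distribs poly_monom assms(2))
qed

lemma cyclic_code_code_of: "cyclic_code n (code_of T)"
proof -
  have "(\<alpha> ^ t) ^ n = 1" for t
    by (metis \<alpha>_power_n mult.commute power_mult power_one)
  moreover have "code_eval (0\<^sub>v n) z = (0 :: 'a alg_closure)" for z
    by (simp add: code_eval_def)
  ultimately show ?thesis
    by (auto simp: cyclic_code_def linear_code_def code_of_def code_eval_add code_eval_smult
        code_eval_cyclic_shift) (simp add: cyclic_shift_def)
qed

end

section \<open>The Hermitian dual of a cyclic code\<close>

locale hermitian_root_of_unity = root_of_unity n \<alpha>
  for n :: nat and \<alpha> :: "'a::{finite,field} alg_closure" +
  fixes q :: nat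
  assumes CARD_eq: "CARD('a) = q\<^sup>2"
    and coprime_n_q: "coprime n q"
begin

definition \<sigma> :: "nat \<Rightarrow> nat" where
  "\<sigma> t = nat ((- int q * int t) mod int n)"

lemma set_mult_mod_eq: "set_mult_mod n (- int q) T = \<sigma> ` T"
  by (simp add: set_mult_mod_def \<sigma>_def)

lemma \<sigma>_less: "\<sigma> t < n"
  using n_pos by (simp add: \<sigma>_def nat_less_iff)

text \<open>The working form of \<open>\<sigma>\<close>: stated as a product, it avoids negative
  exponents and lets later identities be checked on powers of \<alpha>.\<close>

lemma \<alpha>_power_\<sigma>: "\<alpha> ^ \<sigma> t * \<alpha> ^ (q * t) = 1"
proof -
  have "int (\<sigma> t + q * t) mod int n = ((- int q * int t) mod int n + int q * int t) mod int n"
    using n_pos by (simp add: \<sigma>_def)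
  also have "\<dots> = 0"
    by (simp add: mod_add_left_eq)
  finally have "(\<sigma> t + q * t) mod n = 0"
    by (metis of_nat_eq_0_iff zmod_int)
  then show ?thesis
    by (metis \<alpha>_power_mod power_0 power_add)
qed

lemma \<alpha>_power_eq_iff: "\<alpha> ^ i = \<alpha> ^ j \<longleftrightarrow> i mod n = j mod n"
proof
  assume "\<alpha> ^ i = \<alpha> ^ j"
  then have "\<alpha> ^ (i mod n) = \<alpha> ^ (j mod n)" by (simp only: \<alpha>_power_mod)
  then show "i mod n = j mod n" using inj_onD[OF inj_\<alpha>_power] n_pos by simp
qed (metis \<alpha>_power_mod)

lemma inj_\<sigma>: "inj_on \<sigma> {..<n}"
proof (rule inj_onI)
  fix s t assume st: "s \<in> {..<n}" "t \<in> {..<n}" "\<sigma> s = \<sigma> t"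
  then have "\<alpha> ^ \<sigma> t * \<alpha> ^ (q * s) = \<alpha> ^ \<sigma> t * \<alpha> ^ (q * t)"
    using \<alpha>_power_\<sigma>[of s] \<alpha>_power_\<sigma>[of t] by simp
  then have "[q * s = q * t] (mod n)"
    using \<alpha>_nonzero by (simp add: \<alpha>_power_eq_iff Cong.cong_def)
  then have "[s = t] (mod n)"
    using coprime_n_q cong_mult_lcancel_nat[of q n s t] by (simp add: coprime_commute)
  then show "s = t" using st by (simp add: Cong.cong_def)
qed

lemma \<sigma>_image: "\<sigma> ` {..<n} = {..<n}"
  by (rule endo_inj_surj[OF _ _ inj_\<sigma>]) (auto simp: \<sigma>_less)

lemma \<sigma>_surj:
  assumes "s < n"
  obtains t where "t < n" "s = \<sigma> t"
  using assms \<sigma>_image by (metis imageE lessThan_iff)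

lemma \<sigma>_eqI:
  assumes "\<alpha> ^ m * \<alpha> ^ (q * t) = 1"
  shows "\<sigma> t = m mod n"
proof -
  have "\<alpha> ^ \<sigma> t * \<alpha> ^ (q * t) = \<alpha> ^ m * \<alpha> ^ (q * t)"
    by (simp only: assms \<alpha>_power_\<sigma>)
  then have "\<alpha> ^ \<sigma> t = \<alpha> ^ m" using \<alpha>_nonzero by simp
  then show ?thesis using \<sigma>_less[of t] by (simp add: \<alpha>_power_eq_iff)
qed

lemma \<sigma>_\<sigma>: "\<sigma> (\<sigma> t) = t * CARD('a) mod n"
proof (rule \<sigma>_eqI)
  have "t * CARD('a) = q * t * q" "q * \<sigma> t = \<sigma> t * q"
    by (simp_all add: CARD_eq power2_eq_square)
  then have "\<alpha> ^ (t * CARD('a)) * \<alpha> ^ (q * \<sigma> t) = (\<alpha> ^ (q * t) * \<alpha> ^ \<sigma> t) ^ q"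
    by (simp only: power_mult_distrib power_mult)
  then show "\<alpha> ^ (t * CARD('a)) * \<alpha> ^ (q * \<sigma> t) = 1"
    using \<alpha>_power_\<sigma>[of t] by (simp add: mult.commute)
qed

lemma \<sigma>_mult: "\<sigma> (t * m mod n) = \<sigma> t * m mod n"
proof (rule \<sigma>_eqI)
  have "\<alpha> ^ (q * (t * m mod n)) = \<alpha> ^ (q * t * m)"
    unfolding \<alpha>_power_eq_iff by (simp add: mod_mult_right_eq mult.assoc)
  moreover have "\<alpha> ^ (\<sigma> t * m) * \<alpha> ^ (q * t * m) = (\<alpha> ^ \<sigma> t * \<alpha> ^ (q * t)) ^ m"
    by (simp only: power_mult_distrib power_mult)
  ultimately show "\<alpha> ^ (\<sigma> t * m) * \<alpha> ^ (q * (t * m mod n)) = 1"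
    by (simp only: \<alpha>_power_\<sigma> power_one)
qed

section \<open>Cross-correlation and the zeros of the dual\<close>

lemma q_eq_power_CHAR: "\<exists>e. q = CHAR('a) ^ e"
proof -
  obtain e where "q\<^sup>2 = CHAR('a) ^ e" using CARD_eq_power_CHAR CARD_eq by auto
  then have "q dvd CHAR('a) ^ e" by (metis dvd_triv_left power2_eq_square)
  then show ?thesis
    using divides_primepow_nat[OF prime_CHAR_finite[where ?'a = 'a]] by blast
qed

lemma sum_power_q: "(\<Sum>i\<in>A. f i) ^ q = (\<Sum>i\<in>A. (f i :: 'a alg_closure) ^ q)"
proof -
  obtain e where "q = CHAR('a) ^ e" using q_eq_power_CHAR ..
  then show ?thesis using prime_CHAR_finite[where ?'a = 'a] by (intro freshmans_dream_sum') auto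
qed

text \<open>The offset \<open>(n - 1) * j\<close> stands for \<open>- j\<close> modulo
  \<open>n\<close>, which keeps the index a natural number.\<close>

lemma cyclic_shift_funpow:
  assumes "x \<in> carrier_vec n"
  shows "(cyclic_shift n ^^ j) x = vec n (\<lambda>i. x $ ((i + (n - 1) * j) mod n))"
proof (induction j)
  case 0
  then show ?case using assms by (intro eq_vecI) auto
next
  case (Suc j)
  have "((i + n - 1) mod n + (n - 1) * j) mod n = (i + (n - 1) * Suc j) mod n" for i
  proof -
    have "i + n - 1 + (n - 1) * j = i + (n - 1) * Suc j" using n_pos by simp
    then show ?thesis by (metis mod_add_left_eq)
  qed
  then have "cyclic_shift n (vec n (\<lambda>i. x $ ((i + (n - 1) * j) mod n))) =
      vec n (\<lambda>i. x $ ((i + (n - 1) * Suc j) mod n))"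
    unfolding cyclic_shift_def using n_pos by (intro eq_vecI) (simp_all del: One_nat_def)
  then show ?case by (simp only: Suc funpow.simps o_apply)
qed

text \<open>Collects the products of \<open>y\<close> with all shifts of \<open>x\<close>. For
  \<open>x\<close> in a cyclic code and \<open>y\<close> in its dual every entry vanishes; entry 0
  is the Hermitian product itself.\<close>

definition correlation :: "'a vec \<Rightarrow> 'a vec \<Rightarrow> 'a vec" where
  "correlation x y = vec n (\<lambda>j. hermitian_prod q ((cyclic_shift n ^^ j) x) y)"

text \<open>The correlation theorem for the Fourier transform. Substituting the shifted index
  separates the double sum, and the q-th power on the letters of \<open>x\<close> becomes a q-th
  power of its whole transform, which turns the frequency \<open>t\<close> into
  \<open>- q * t\<close>.\<close>

lemma code_eval_correlation:
  assumes x: "x \<in> carrier_vec n" and y: "y \<in> carrier_vec n"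
  shows "code_eval (correlation x y) (\<alpha> ^ \<sigma> t) = code_eval y (\<alpha> ^ \<sigma> t) * code_eval x (\<alpha> ^ t) ^ q"
proof -
  define z where "z = \<alpha> ^ \<sigma> t"
  let ?r = "\<lambda>i j. (i + (n - 1) * j) mod n"
  have z_mod: "z ^ (i mod n) = z ^ i" for i
  proof -
    have "z ^ (i mod n) = \<alpha> ^ (\<sigma> t * (i mod n))" by (simp only: z_def power_mult)
    also have "\<dots> = \<alpha> ^ (\<sigma> t * i)" unfolding \<alpha>_power_eq_iff by (simp add: mod_mult_right_eq)
    finally show ?thesis by (simp only: z_def power_mult)
  qed
  have z_inv: "z ^ (n - 1) = \<alpha> ^ (q * t)"
  proof -
    have "z * z ^ (n - 1) = z ^ n" using n_pos by (metis One_nat_def Suc_pred power_Suc)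
    also have "\<dots> = 1" using z_mod[of n] by simp
    also have "\<dots> = z * \<alpha> ^ (q * t)" by (simp add: z_def \<alpha>_power_\<sigma>)
    finally show ?thesis using \<alpha>_nonzero by (simp add: z_def)
  qed
  \<comment> \<open>For fixed \<open>i\<close> the map from \<open>j\<close> to \<open>i - j\<close>
    modulo \<open>n\<close> is an involution, so it can serve as the substitution in the inner
    sum.\<close>
  have r_r: "?r i (?r i j) = j" if "j < n" for i j
  proof -
    have eq: "?r i (?r i j) = (i + (n - 1) * (i + (n - 1) * j)) mod n"
      by (metis mod_add_right_eq mod_mult_right_eq)
    consider "n = 1" | k where "n = k + 2"
      using n_pos by (metis One_nat_def Suc_pred add_2_eq_Suc' not0_implies_Suc)
    then show ?thesis
    proof cases
      case 1
      then show ?thesis using that by simp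
    next
      case 2
      have "i + (n - 1) * (i + (n - 1) * j) = j + n * (i + k * j)"
        by (simp add: 2 algebra_simps)
      then show ?thesis using that unfolding eq by simp
    qed
  qed
  have bij: "bij_betw (?r i) {..<n} {..<n}" for i
    by (rule bij_betw_byWitness[where f' = "?r i"]) (use n_pos r_r in auto)
  have inner: "(\<Sum>j<n. to_ac (x $ ?r i j) ^ q * z ^ j) = z ^ i * code_eval x (\<alpha> ^ t) ^ q" for i
  proof -
    have "(\<Sum>j<n. to_ac (x $ ?r i j) ^ q * z ^ j) = (\<Sum>j<n. to_ac (x $ ?r i j) ^ q * z ^ ?r i (?r i j))"
      by (rule sum.cong) (simp_all only: r_r lessThan_iff)
    also have "\<dots> = (\<Sum>l<n. to_ac (x $ l) ^ q * z ^ ?r i l)"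
      by (rule sum.reindex_bij_betw[OF bij])
    also have "\<dots> = (\<Sum>l<n. z ^ i * (to_ac (x $ l) * (\<alpha> ^ t) ^ l) ^ q)"
    proof (rule sum.cong)
      fix l
      have "z ^ ?r i l = z ^ i * (z ^ (n - 1)) ^ l"
        by (simp only: z_mod power_add power_mult)
      also have "(z ^ (n - 1)) ^ l = ((\<alpha> ^ t) ^ l) ^ q"
        unfolding z_inv power_mult[symmetric] by (simp only: mult_ac)
      finally show "to_ac (x $ l) ^ q * z ^ ?r i l = z ^ i * (to_ac (x $ l) * (\<alpha> ^ t) ^ l) ^ q"
        by (simp only: power_mult_distrib mult_ac)
    qed simp
    also have "\<dots> = z ^ i * code_eval x (\<alpha> ^ t) ^ q"
      using x by (simp add: code_eval_def sum_power_q sum_distrib_left)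
    finally show ?thesis .
  qed
  have "code_eval (correlation x y) z =
      (\<Sum>j<n. (\<Sum>i<n. to_ac (x $ ?r i j) ^ q * to_ac (y $ i)) * z ^ j)"
    by (simp add: code_eval_def correlation_def hermitian_prod_def cyclic_shift_funpow[OF x] to_ac_sum)
  also have "\<dots> = (\<Sum>j<n. \<Sum>i<n. to_ac (y $ i) * (to_ac (x $ ?r i j) ^ q * z ^ j))"
    unfolding sum_distrib_right by (simp only: mult_ac)
  also have "\<dots> = (\<Sum>i<n. \<Sum>j<n. to_ac (y $ i) * (to_ac (x $ ?r i j) ^ q * z ^ j))"
    by (rule sum.swap)
  also have "\<dots> = (\<Sum>i<n. to_ac (y $ i) * (z ^ i * code_eval x (\<alpha> ^ t) ^ q))"
    by (simp only: sum_distrib_left[symmetric] inner)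
  also have "\<dots> = code_eval y z * code_eval x (\<alpha> ^ t) ^ q"
    using y by (simp add: code_eval_def sum_distrib_right mult.assoc)
  finally show ?thesis by (simp add: z_def)
qed

text \<open>Injectivity of the transform, obtained by counting: the code has
  \<open>CARD('a) ^ 0\<close> words.\<close>

lemma code_of_lessThan_n: "code_of {..<n} = {0\<^sub>v n}"
proof -
  have "card (code_of {..<n}) = 1"
    using card_code[OF is_defining_set_code_of[of "{..<n}"]] n_pos by simp
  then obtain c where "code_of {..<n} = {c}" by (rule card_1_singletonE)
  moreover have "0\<^sub>v n \<in> code_of {..<n}"
    using cyclic_code_code_of by (simp add: cyclic_code_def linear_code_def)
  ultimately show ?thesis by simp
qed

text \<open>Orthogonality to all of \<open>D\<close> means that every correlation has zero
  transform. If \<open>t\<close> is outside the defining set, some \<open>x\<close> in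
  \<open>D\<close> has nonzero transform at \<open>t\<close>, which forces that of \<open>y\<close>
  to vanish at \<open>\<sigma> t\<close>; conversely one factor of each product is zero.\<close>

lemma hermitian_dual_cyclic:
  assumes D: "cyclic_code n D"
  shows "hermitian_dual q n D = code_of ({..<n} - \<sigma> ` defining_set \<alpha> n D)"
proof (intro equalityI subsetI)
  let ?T = "defining_set \<alpha> n D"
  have carr: "x \<in> carrier_vec n" if "x \<in> D" for x
    using D that by (auto simp: cyclic_code_def linear_code_def)
  have shifts: "(cyclic_shift n ^^ j) x \<in> D" if "x \<in> D" for x j
    using that D by (induction j) (auto simp: cyclic_code_def)
  {
    fix y assume y: "y \<in> hermitian_dual q n D"
    have "code_eval y (\<alpha> ^ s) = 0" if s: "s \<in> {..<n} - \<sigma> ` ?T" for s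
    proof -
      obtain t where t: "t < n" "s = \<sigma> t" using s \<sigma>_surj[of s] by auto
      then have "t \<notin> ?T" using s by auto
      then obtain x where x: "x \<in> D" "code_eval x (\<alpha> ^ t) \<noteq> 0"
        using t mem_defining_set_iff[OF D] by auto
      have "correlation x y = 0\<^sub>v n"
        using y shifts[OF x(1)] by (intro eq_vecI) (auto simp: correlation_def hermitian_dual_def)
      then have "code_eval (correlation x y) (\<alpha> ^ \<sigma> t) = 0"
        by (simp add: code_eval_def)
      then show ?thesis
        using code_eval_correlation[OF carr[OF x(1)], of y t] x(2) y t
        by (simp add: hermitian_dual_def)
    qed
    then show "y \<in> code_of ({..<n} - \<sigma> ` ?T)"
      using y by (auto simp: code_of_def hermitian_dual_def)
  }
  {
    fix y assume y: "y \<in> code_of ({..<n} - \<sigma> ` ?T)"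
    have "hermitian_prod q x y = 0" if x: "x \<in> D" for x
    proof -
      have "code_eval (correlation x y) (\<alpha> ^ s) = 0" if "s < n" for s
      proof -
        obtain t where t: "t < n" "s = \<sigma> t" using \<sigma>_surj[OF \<open>s < n\<close>] by blast
        have "code_eval y (\<alpha> ^ \<sigma> t) * code_eval x (\<alpha> ^ t) ^ q = 0"
        proof (cases "t \<in> ?T")
          case True
          then have "code_eval x (\<alpha> ^ t) = 0" using mem_defining_set_iff[OF D] x by blast
          \<comment> \<open>Needed since \<open>0 ^ 0 = 1\<close>: the vanishing transform of
            \<open>x\<close> appears to the power \<open>q\<close>.\<close>
          moreover have "q > 0" using CARD_eq CARD_field_gt_1[where ?'a = 'a] by (cases "q = 0") auto
          ultimately show ?thesis by simp
        next
          case False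
          then have "\<sigma> t \<notin> \<sigma> ` ?T"
            using t inj_\<sigma> mem_defining_set_iff[OF D] by (auto dest: inj_onD)
          then have "code_eval y (\<alpha> ^ \<sigma> t) = 0" using y \<sigma>_less by (auto simp: code_of_def)
          then show ?thesis by simp
        qed
        then show ?thesis
          using code_eval_correlation[OF carr[OF x], of y t] y t by (simp add: code_of_def)
      qed
      then have "correlation x y \<in> code_of {..<n}"
        by (simp add: code_of_def correlation_def)
      then have "correlation x y $ 0 = 0" using n_pos by (simp add: code_of_lessThan_n)
      then show ?thesis using n_pos by (simp add: correlation_def)
    qed
    then show "y \<in> hermitian_dual q n D" using y by (auto simp: code_of_def hermitian_dual_def)
  }
qed

text \<open>\<open>\<sigma>\<close> commutes with multiplication by \<open>CARD('a)\<close>, and the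
  defining set of \<open>D\<close> and its complement are both stable under the latter; so the set
  of zeros found for the dual is rational.\<close>

lemma defining_set_hermitian_dual:
  assumes D: "cyclic_code n D"
  shows "cyclic_code n (hermitian_dual q n D)"
    and "defining_set \<alpha> n (hermitian_dual q n D) = {..<n} - \<sigma> ` defining_set \<alpha> n D"
proof -
  show "cyclic_code n (hermitian_dual q n D)"
    by (simp add: hermitian_dual_cyclic[OF D] cyclic_code_code_of)
  have "s * CARD('a) mod n \<in> {..<n} - \<sigma> ` defining_set \<alpha> n D"
    if s: "s \<in> {..<n} - \<sigma> ` defining_set \<alpha> n D" for s
  proof -
    obtain t where t: "t < n" "s = \<sigma> t" using s \<sigma>_surj[of s] by auto
    then have "t \<notin> defining_set \<alpha> n D" using s by auto
    then have "t * CARD('a) mod n \<notin> defining_set \<alpha> n D"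
      using mod_CARD_mem_defining_set_iff[OF D] t by blast
    then have "\<sigma> (t * CARD('a) mod n) \<notin> \<sigma> ` defining_set \<alpha> n D"
      using inj_\<sigma> mem_defining_set_iff[OF D] n_pos by (auto dest: inj_onD)
    then show ?thesis using n_pos t by (simp add: \<sigma>_mult)
  qed
  then show "defining_set \<alpha> n (hermitian_dual q n D) = {..<n} - \<sigma> ` defining_set \<alpha> n D"
    unfolding hermitian_dual_cyclic[OF D]
    by (intro defining_set_eqI is_defining_set_code_of) auto
qed

text \<open>Cosets are closed under multiplication by q^2 by construction. In the other direction
  q^2 is invertible modulo \<open>n\<close>, and by Euler's theorem its inverse is again a power of
  it.\<close>

lemma mod_CARD_mem_union_of_cosets_iff:
  assumes T: "union_of_cyclotomic_cosets q n T" and t: "t < n"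
  shows "t * CARD('a) mod n \<in> T \<longleftrightarrow> t \<in> T"
proof -
  obtain S where S: "T = (\<Union>x\<in>S. cyclotomic_coset q n x)"
    using T by (auto simp: union_of_cyclotomic_cosets_def)
  have step: "s * CARD('a) ^ j mod n \<in> T" if s: "s \<in> T" for s j
  proof -
    obtain x i where x: "x \<in> S" "s = x * q ^ (2 * i) mod n"
      using s by (auto simp: S cyclotomic_coset_def)
    have "s * CARD('a) ^ j mod n = x * q ^ (2 * i) * q ^ (2 * j) mod n"
      unfolding x(2) by (simp only: mod_mult_left_eq CARD_eq power_mult)
    also have "\<dots> = x * q ^ (2 * (i + j)) mod n"
      by (simp only: mult.assoc power_add[symmetric] distrib_left)
    finally have "s * CARD('a) ^ j mod n \<in> cyclotomic_coset q n x"
      unfolding cyclotomic_coset_def by blast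
    then show ?thesis using x S by auto
  qed
  show ?thesis
  proof
    assume "t \<in> T"
    then show "t * CARD('a) mod n \<in> T" using step[of t 1] by simp
  next
    assume tQ: "t * CARD('a) mod n \<in> T"
    have "coprime CARD('a) n" using coprime_n_q by (simp add: CARD_eq coprime_commute)
    then have euler: "[CARD('a) ^ totient n = 1] (mod n)" by (rule euler_theorem)
    have "totient n > 0" using n_pos by simp
    then have pow: "CARD('a) * CARD('a) ^ (totient n - 1) = CARD('a) ^ totient n"
      by (metis Suc_diff_1 power_Suc)
    have "(t * CARD('a) mod n) * CARD('a) ^ (totient n - 1) mod n = t * CARD('a) ^ totient n mod n"
      unfolding mod_mult_left_eq mult.assoc pow ..
    also have "\<dots> = t * 1 mod n"
      using cong_scalar_left[OF euler, of t] by (simp only: Cong.cong_def)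
    also have "\<dots> = t" using t by simp
    finally show "t \<in> T" using step[OF tQ, of "totient n - 1"] by simp
  qed
qed

lemma mod_CARD_mem_\<sigma>_image_iff:
  assumes T: "union_of_cyclotomic_cosets q n T" "T \<subseteq> {..<n}" and t: "t < n"
  shows "t * CARD('a) mod n \<in> \<sigma> ` T \<longleftrightarrow> t \<in> \<sigma> ` T"
proof -
  obtain s where s: "s < n" "t = \<sigma> s" using \<sigma>_surj[OF t] .
  have \<sigma>_mem: "\<sigma> u \<in> \<sigma> ` T \<longleftrightarrow> u \<in> T" if "u < n" for u
    using that T(2) inj_\<sigma> by (auto dest: inj_onD)
  have "t * CARD('a) mod n = \<sigma> (s * CARD('a) mod n)" by (simp add: s \<sigma>_mult)
  then show ?thesis
    using \<sigma>_mem[of "s * CARD('a) mod n"] \<sigma>_mem[of s] mod_CARD_mem_union_of_cosets_iff[OF T(1), of s] s n_pos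
    by simp
qed

end

section \<open>From Hermitian to symplectic duality\<close>

lemma abs_trace_zero: "abs_trace (0 :: 'b::{finite,field}) = 0"
proof -
  have "CHAR('b) > 0"
    using prime_CHAR_finite[where ?'a = 'b] by (rule prime_gt_0_nat)
  then show ?thesis by (simp add: abs_trace_def power_0_left)
qed

text \<open>The trace is a nonzero polynomial of degree at most \<open>p ^ (m - 1)\<close>, below
  the order of the field.\<close>

lemma abs_trace_nontrivial:
  assumes "primepow CARD('b::{finite,field})"
  shows "\<exists>x :: 'b. abs_trace x \<noteq> 0"
proof -
  obtain p m where p: "normalization_semidom_class.prime p" and m: "m > 0" and card: "CARD('b) = p ^ m"
    using assms by (auto simp: primepow_def)
  have p1: "p > 1" using p by (rule prime_gt_1_nat)
  have char: "CHAR('b) = p" using CHAR_eqI_CARD[OF p card] .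
  have mult: "multiplicity CHAR('b) CARD('b) = m"
    unfolding char card using p by (intro multiplicity_same_power) (auto simp: p1)
  define P where "P = (\<Sum>i<m. Polynomial.monom (1::'b) (p ^ i))"
  have "poly.coeff P (p ^ (m - 1)) = (\<Sum>i<m. if i = m - 1 then 1 else 0)"
    unfolding P_def coeff_sum by (rule sum.cong) (use p1 in auto)
  then have "poly.coeff P (p ^ (m - 1)) = 1" using m by simp
  then have "P \<noteq> 0" by auto
  have "p ^ i \<le> p ^ (m - 1)" if "i < m" for i
    using that p1 by (intro power_increasing) auto
  then have "Polynomial.degree P \<le> p ^ (m - 1)"
    unfolding P_def by (intro degree_sum_le) (auto simp: degree_monom_eq)
  also have "\<dots> < p ^ m" using m p1 by (intro power_strict_increasing) auto
  finally have "Polynomial.degree P < CARD('b)" by (simp add: card)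
  with \<open>P \<noteq> 0\<close> obtain x where "poly P x \<noteq> 0" using ex_nonroot by blast
  then have "abs_trace x \<noteq> 0"
    by (simp add: abs_trace_def mult char P_def poly_sum poly_monom) (simp add: char mult[unfolded char] flip: card)
  then show ?thesis ..
qed

text \<open>With coordinates \<open>x = a + b \<beta>\<close> over the subfield with \<open>q\<close> elements one has
  \<open>(a' b - a b') (\<beta> - \<beta>\<^sup>q) = x'\<^sup>q x - x' x\<^sup>q\<close>, so the symplectic form of two words is
  determined by \<open>h\<^sup>q - h\<close>, where \<open>h\<close> is their Hermitian product.  On a linear code the
  latter can be scaled to any value as soon as it is nonzero.\<close>
lemma symplectic_coordinates:
  fixes n q :: nat
  assumes q: "primepow q" "CARD('a::{finite,field}) = q\<^sup>2" "CARD('b::{finite,field}) = q"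
  obtains \<Phi> :: "'a::{finite,field} vec \<Rightarrow> 'b::{finite,field} vec \<times> 'b vec" where
    "bij_betw \<Phi> (carrier_vec n) (carrier_vec n \<times> carrier_vec n)"
    "\<And>x y. x \<in> carrier_vec n \<Longrightarrow> y \<in> carrier_vec n \<Longrightarrow>
       \<Phi> (x + y) = (fst (\<Phi> x) + fst (\<Phi> y), snd (\<Phi> x) + snd (\<Phi> y))"
    "\<And>x. x \<in> carrier_vec n \<Longrightarrow> swt (\<Phi> x) = hamming_wt x"
    "\<And>C. linear_code n C \<Longrightarrow> symplectic_dual n (\<Phi> ` C) = \<Phi> ` hermitian_dual q n C"
proof -
  obtain p m where p: "normalization_semidom_class.prime p" and m: "m > 0" and qpm: "q = p ^ m"
    using q(1) by (auto simp: primepow_def)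
  have q1: "q > 1" using CARD_field_gt_1[where ?'a = 'b] q by simp
  have charb: "CHAR('b) = p" using CHAR_eqI_CARD[OF p, of m] q qpm by simp
  have "CARD('a) = p ^ (m * 2)" using q(2) by (simp add: qpm power_mult)
  then have chara: "CHAR('a) = p" using CHAR_eqI_CARD[OF p] by blast
  obtain \<iota> :: "'b \<Rightarrow> 'a" where "field_hom \<iota>"
    using finite_field_embedding[where ?'a = 'a and ?'b = 'b and k = 2] q chara charb by auto
  then interpret i: field_hom \<iota> .
  have frob_add: "(x + y) ^ q = x ^ q + y ^ q" for x y :: 'a
    by (rule freshmans_dream'[where n = m]) (simp_all add: chara p qpm)
  have frob_sum: "(\<Sum>i\<in>A. f i) ^ q = (\<Sum>i\<in>A. f i ^ q)" for A :: "nat set" and f :: "nat \<Rightarrow> 'a"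
    by (rule freshmans_dream_sum'[where n = m]) (simp_all add: chara p qpm)
  have frob_frob: "(x ^ q) ^ q = x" for x :: 'a
    using power_CARD_eq_self[of x] by (simp add: q(2) power2_eq_square power_mult)
  have frob_\<iota>: "\<iota> a ^ q = \<iota> a" for a
    using power_CARD_eq_self[of a] q(3) by (metis i.hom_power)
  \<comment> \<open>x^q - x has degree at most q, below q^2, so some \<open>\<beta>\<close> is not
    fixed by the q-th power. The image of \<open>\<iota>\<close> is fixed, hence 1 and
    \<open>\<beta>\<close> are independent over it.\<close>
  define P where "P = Polynomial.monom (1::'a) q - Polynomial.monom 1 1"
  have "poly.coeff P q = 1" using q1 by (simp add: P_def)
  then have "P \<noteq> 0" by auto
  have "Polynomial.degree P \<le> q"
    unfolding P_def using q1 by (intro degree_diff_le) (auto simp: degree_monom_eq)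
  also have "q < CARD('a)" using q1 by (simp add: q(2) power2_eq_square)
  finally obtain \<beta> where "poly P \<beta> \<noteq> 0" using ex_nonroot[OF \<open>P \<noteq> 0\<close>] by blast
  then have \<beta>: "\<beta> ^ q \<noteq> \<beta>" by (simp add: P_def poly_monom)
  define \<psi> where "\<psi> = (\<lambda>(a, b). \<iota> a + \<iota> b * \<beta>)"
  have "inj \<psi>"
  proof (rule injI)
    fix u v :: "'b \<times> 'b" assume "\<psi> u = \<psi> v"
    then obtain a b a' b' where uv: "u = (a, b)" "v = (a', b')"
      and eq: "\<iota> a + \<iota> b * \<beta> = \<iota> a' + \<iota> b' * \<beta>"
      by (cases u; cases v) (auto simp: \<psi>_def)
    have "b = b'"
    proof (rule ccontr)
      assume "b \<noteq> b'"
      have "\<iota> (b - b') * \<beta> = \<iota> (a' - a)"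
        using eq by (simp add: i.hom_minus algebra_simps)
      then have "\<beta> = \<iota> (a' - a) / \<iota> (b - b')"
        using \<open>b \<noteq> b'\<close> by (simp add: field_simps)
      then have "\<beta> = \<iota> ((a' - a) / (b - b'))" by (simp add: i.hom_div)
      then show False using \<beta> frob_\<iota> by metis
    qed
    then show "u = v" using eq uv by simp
  qed
  moreover have "CARD('b \<times> 'b) = CARD('a)" by (simp add: q power2_eq_square)
  ultimately have "bij \<psi>"
    by (metis bij_betw_def card_image finite_code card_seteq finite_UNIV subset_UNIV le_refl)
  define \<kappa> where "\<kappa> = inv_into UNIV \<psi>"
  have \<psi>\<kappa>: "\<psi> (\<kappa> x) = x" and \<kappa>\<psi>: "\<kappa> (\<psi> u) = u" for x u
    using \<open>bij \<psi>\<close> by (simp_all add: \<kappa>_def bij_is_surj surj_f_inv_f bij_is_inj)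
  have coords: "\<iota> (fst (\<kappa> x)) + \<iota> (snd (\<kappa> x)) * \<beta> = x" for x
    using \<psi>\<kappa>[of x] by (simp add: \<psi>_def case_prod_beta)
  have \<kappa>_add: "\<kappa> (x + y) = (fst (\<kappa> x) + fst (\<kappa> y), snd (\<kappa> x) + snd (\<kappa> y))" for x y
  proof -
    have "\<psi> (fst (\<kappa> x) + fst (\<kappa> y), snd (\<kappa> x) + snd (\<kappa> y)) = x + y"
      using coords[of x] coords[of y] by (simp add: \<psi>_def i.hom_add algebra_simps)
    then show ?thesis using \<kappa>\<psi> by metis
  qed
  have \<kappa>_zero_iff: "\<kappa> x = (0, 0) \<longleftrightarrow> x = 0" for x
  proof -
    have "\<psi> (0, 0) = 0" by (simp add: \<psi>_def)
    then show ?thesis using \<kappa>\<psi> \<psi>\<kappa> by metis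
  qed
  define \<Phi> where "\<Phi> x = (map_vec (fst \<circ> \<kappa>) x, map_vec (snd \<circ> \<kappa>) x)" for x :: "'a vec"
  define \<Phi>' where "\<Phi>' u = vec n (\<lambda>i. \<psi> (fst u $ i, snd u $ i))" for u :: "'b vec \<times> 'b vec"
  have bij: "bij_betw \<Phi> (carrier_vec n) (carrier_vec n \<times> carrier_vec n)"
  proof (rule bij_betw_byWitness[where f' = \<Phi>'])
    show "\<forall>x\<in>carrier_vec n. \<Phi>' (\<Phi> x) = x"
      by (auto simp: \<Phi>_def \<Phi>'_def \<psi>\<kappa>)
    show "\<forall>u\<in>carrier_vec n \<times> carrier_vec n. \<Phi> (\<Phi>' u) = u"
      by (auto simp: \<Phi>_def \<Phi>'_def \<kappa>\<psi>)
  qed (auto simp: \<Phi>_def \<Phi>'_def)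
  have add: "\<Phi> (x + y) = (fst (\<Phi> x) + fst (\<Phi> y), snd (\<Phi> x) + snd (\<Phi> y))"
    if "x \<in> carrier_vec n" "y \<in> carrier_vec n" for x y
    using that by (auto simp: \<Phi>_def \<kappa>_add)
  have swt: "swt (\<Phi> x) = hamming_wt x" if "x \<in> carrier_vec n" for x
  proof -
    have "(fst (\<kappa> z), snd (\<kappa> z)) \<noteq> (0, 0) \<longleftrightarrow> z \<noteq> 0" for z
      using \<kappa>_zero_iff[of z] by (simp add: prod_eq_iff)
    then have "{i. i < dim_vec x \<and> (map_vec (fst \<circ> \<kappa>) x $ i, map_vec (snd \<circ> \<kappa>) x $ i) \<noteq> (0, 0)} =
        {i. i < dim_vec x \<and> x $ i \<noteq> 0}"
      by (intro Collect_cong conj_cong refl) (simp only: index_map_vec o_apply)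
    then show ?thesis
      by (simp only: swt_def hamming_wt_def \<Phi>_def prod.case index_map_vec)
  qed
  define W where "W x y = fst (\<Phi> y) \<bullet> snd (\<Phi> x) - fst (\<Phi> x) \<bullet> snd (\<Phi> y)" for x y
  have trace: "trace_symplectic (\<Phi> x) (\<Phi> y) = abs_trace (W x y)" for x y
    by (simp add: trace_symplectic_def W_def case_prod_beta)
  have W: "\<iota> (W x y) * (\<beta> - \<beta> ^ q) = hermitian_prod q x y ^ q - hermitian_prod q x y"
    if x: "x \<in> carrier_vec n" and y: "y \<in> carrier_vec n" for x y
  proof -
    have W_sum: "W x y = (\<Sum>i<n. fst (\<kappa> (y $ i)) * snd (\<kappa> (x $ i)) - fst (\<kappa> (x $ i)) * snd (\<kappa> (y $ i)))"
      using x y by (simp add: W_def \<Phi>_def scalar_prod_def sum_subtractf atLeast0LessThan)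
    have coord_form: "(\<iota> (fst (\<kappa> v)) * \<iota> (snd (\<kappa> u)) - \<iota> (fst (\<kappa> u)) * \<iota> (snd (\<kappa> v))) * (\<beta> - \<beta> ^ q)
        = v ^ q * u - u ^ q * v" for u v
    proof -
      have frob: "z ^ q = \<iota> (fst (\<kappa> z)) + \<iota> (snd (\<kappa> z)) * \<beta> ^ q" for z
        using coords[of z] by (metis frob_add frob_\<iota> power_mult_distrib)
      define a b a' b' where "a = \<iota> (fst (\<kappa> u))" and "b = \<iota> (snd (\<kappa> u))"
        and "a' = \<iota> (fst (\<kappa> v))" and "b' = \<iota> (snd (\<kappa> v))"
      note defs = this
      have "v ^ q * u - u ^ q * v = (a' + b' * \<beta> ^ q) * (a + b * \<beta>) - (a + b * \<beta> ^ q) * (a' + b' * \<beta>)"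
        by (simp only: frob[of u] frob[of v] coords[of u] coords[of v] defs)
      also have "\<dots> = (a' * b - a * b') * (\<beta> - \<beta> ^ q)"
        by (simp add: algebra_simps)
      finally show ?thesis by (simp only: defs)
    qed
    have "\<iota> (W x y) * (\<beta> - \<beta> ^ q) = (\<Sum>i<n. (y $ i) ^ q * x $ i - (x $ i) ^ q * y $ i)"
      unfolding W_sum by (simp add: i.hom_sum i.hom_minus i.hom_mult sum_distrib_right coord_form)
    also have "\<dots> = (\<Sum>i<n. ((x $ i) ^ q * y $ i) ^ q) - (\<Sum>i<n. (x $ i) ^ q * y $ i)"
      by (simp add: sum_subtractf power_mult_distrib frob_frob mult.commute)
    also have "\<dots> = hermitian_prod q x y ^ q - hermitian_prod q x y"
      using x by (simp add: hermitian_prod_def frob_sum)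
    finally show ?thesis .
  qed
  have \<beta>_diff: "\<beta> - \<beta> ^ q \<noteq> 0" using \<beta> by auto
  have dual: "symplectic_dual n (\<Phi> ` C) = \<Phi> ` hermitian_dual q n C" if C: "linear_code n C" for C
  proof (intro equalityI subsetI)
    fix v assume v: "v \<in> \<Phi> ` hermitian_dual q n C"
    then obtain y where y: "y \<in> carrier_vec n" "\<And>x. x \<in> C \<Longrightarrow> hermitian_prod q x y = 0" "v = \<Phi> y"
      by (auto simp: hermitian_dual_def)
    have "trace_symplectic (\<Phi> x) v = 0" if "x \<in> C" for x
    proof -
      have "x \<in> carrier_vec n" using that C by (auto simp: linear_code_def)
      then have "\<iota> (W x y) * (\<beta> - \<beta> ^ q) = 0" using W y that q1 by (simp add: power_0_left)
      then have "W x y = 0" using \<beta>_diff by simp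
      then show ?thesis using y by (simp add: trace abs_trace_zero)
    qed
    then show "v \<in> symplectic_dual n (\<Phi> ` C)"
      using bij_betwE[OF bij] y by (auto simp: symplectic_dual_def)
  next
    fix v assume v: "v \<in> symplectic_dual n (\<Phi> ` C)"
    then obtain y where y: "y \<in> carrier_vec n" "v = \<Phi> y"
      using bij_betw_imp_surj_on[OF bij] by (force simp: symplectic_dual_def)
    have "hermitian_prod q x y = 0" if x: "x \<in> C" for x
    proof (rule ccontr)
      define h where "h = hermitian_prod q x y"
      assume "hermitian_prod q x y \<noteq> 0"
      then have h: "h \<noteq> 0" by (simp add: h_def)
      have carr: "x \<in> carrier_vec n" using x C by (auto simp: linear_code_def)
      have "abs_trace w = 0" for w :: 'b
      proof -
        \<comment> \<open>The Hermitian product is multiplied by \<open>c ^ q\<close> when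
          \<open>x\<close> is scaled by \<open>c\<close>, and taking q-th powers twice is the
          identity, so the scaled product is \<open>- (\<iota> w * \<beta>)\<close>. For this value
          h^q - h equals \<open>\<iota> w * (\<beta> - \<beta> ^ q)\<close>, and the symplectic form
          before the trace is \<open>w\<close>.\<close>
        define c where "c = (- (\<iota> w * \<beta>) / h) ^ q"
        have "c \<cdot>\<^sub>v x \<in> C" using x C by (auto simp: linear_code_def)
        have "hermitian_prod q (c \<cdot>\<^sub>v x) y = c ^ q * h"
          using carr by (simp add: hermitian_prod_def h_def sum_distrib_left power_mult_distrib mult.assoc)
        also have "\<dots> = - (\<iota> w * \<beta>)" using h by (simp add: c_def frob_frob)
        finally have hp: "hermitian_prod q (c \<cdot>\<^sub>v x) y = \<iota> (- w) * \<beta>" by (simp add: i.hom_uminus)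
        have "\<iota> (W (c \<cdot>\<^sub>v x) y) * (\<beta> - \<beta> ^ q) = \<iota> (- w) * \<beta> ^ q - \<iota> (- w) * \<beta>"
          using W[of "c \<cdot>\<^sub>v x" y] carr y unfolding hp by (simp only: power_mult_distrib frob_\<iota> smult_carrier_vec)
        also have "\<dots> = \<iota> w * (\<beta> - \<beta> ^ q)" by (simp add: i.hom_uminus algebra_simps)
        finally have "W (c \<cdot>\<^sub>v x) y = w" using \<beta>_diff by simp
        moreover have "trace_symplectic (\<Phi> (c \<cdot>\<^sub>v x)) v = 0"
          using v \<open>c \<cdot>\<^sub>v x \<in> C\<close> by (auto simp: symplectic_dual_def)
        ultimately show ?thesis by (simp add: y trace)
      qed
      then show False using abs_trace_nontrivial[where ?'b = 'b] q by simp
    qed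
    then show "v \<in> \<Phi> ` hermitian_dual q n C" using y by (auto simp: hermitian_dual_def)
  qed
  show thesis by (rule that[OF bij add swt dual])
qed

section \<open>Weights and the subsystem code attached to \<open>C\<close>\<close>

lemma hamming_wt_eq_0_iff: "hamming_wt x = 0 \<longleftrightarrow> x = 0\<^sub>v (dim_vec x)"
  by (auto simp: hamming_wt_def vec_eq_iff)

lemma swt_eq_0_iff:
  assumes "dim_vec x = dim_vec y"
  shows "swt (x, y) = 0 \<longleftrightarrow> (x, y) = (0\<^sub>v (dim_vec x), 0\<^sub>v (dim_vec y))"
  using assms by (auto simp: swt_def vec_eq_iff)

text \<open>The additive code is the coordinate image of \<open>C\<close>. The size conditions are
  products of naturals, to be turned into real quotients, and \<open>ne\<close> selects the distance
  over the set difference.\<close>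

lemma subsystem_code_of_hermitian:
  fixes C :: "'a::{finite,field} vec set"
  assumes q: "primepow q" "CARD('a) = q\<^sup>2" "CARD('b::{finite,field}) = q"
    and C: "linear_code n C"
    and D: "D = C \<inter> hermitian_dual q n C" "linear_code n D"
    and ne: "hermitian_dual q n D \<noteq> C"
    and card_C: "card C * K = q ^ n * R" and card_D: "card D * (K * R) = q ^ n"
  shows "\<exists>U :: ('b vec \<times> 'b vec) set. subsystem_code n K R (min_wt (hermitian_dual q n D - C)) U"
proof -
  obtain \<Phi> :: "'a vec \<Rightarrow> 'b vec \<times> 'b vec" where
    bij: "bij_betw \<Phi> (carrier_vec n) (carrier_vec n \<times> carrier_vec n)" and
    add: "\<And>x y. x \<in> carrier_vec n \<Longrightarrow> y \<in> carrier_vec n \<Longrightarrow>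
       \<Phi> (x + y) = (fst (\<Phi> x) + fst (\<Phi> y), snd (\<Phi> x) + snd (\<Phi> y))" and
    swt: "\<And>x. x \<in> carrier_vec n \<Longrightarrow> swt (\<Phi> x) = hamming_wt x" and
    dual: "\<And>C. linear_code n C \<Longrightarrow> symplectic_dual n (\<Phi> ` C) = \<Phi> ` hermitian_dual q n C"
    by (rule symplectic_coordinates[OF q, where n = n]) (rule that)
  have inj: "inj_on \<Phi> (carrier_vec n)" using bij by (rule bij_betw_imp_inj_on)
  have carr: "\<Phi> x \<in> carrier_vec n \<times> carrier_vec n" if "x \<in> carrier_vec n" for x
    using bij_betwE[OF bij] that by blast
  have subC: "C \<subseteq> carrier_vec n" using C by (auto simp: linear_code_def)
  have subD: "D \<subseteq> carrier_vec n" using D(2) by (auto simp: linear_code_def)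
  have subH: "hermitian_dual q n E \<subseteq> carrier_vec n" for E :: "'a vec set"
    by (auto simp: hermitian_dual_def)
  have zero_iff: "swt (\<Phi> x) = 0 \<longleftrightarrow> fst (\<Phi> x) = 0\<^sub>v n \<and> snd (\<Phi> x) = 0\<^sub>v n" if "x \<in> carrier_vec n" for x
    using carr[OF that] swt_eq_0_iff[of "fst (\<Phi> x)" "snd (\<Phi> x)"] by (auto simp: mem_Times_iff prod_eq_iff)
  have zero: "\<Phi> (0\<^sub>v n) = (0\<^sub>v n, 0\<^sub>v n)"
    using zero_iff[of "0\<^sub>v n"] swt[of "0\<^sub>v n"] by (auto simp: hamming_wt_eq_0_iff prod_eq_iff)
  \<comment> \<open>Excluding the zero vector amounts to excluding weight 0 on either side, so the
    two minima range over the same set of weights.\<close>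
  have min: "min_swt (\<Phi> ` E) = min_wt E" if E: "E \<subseteq> carrier_vec n" for E
  proof -
    have "{(x, y) \<in> \<Phi> ` E. (x, y) \<noteq> (0\<^sub>v (dim_vec x), 0\<^sub>v (dim_vec y))} = {u \<in> \<Phi> ` E. swt u \<noteq> 0}"
      (is "?L = ?R")
    proof (rule Set.set_eqI)
      fix u :: "'b vec \<times> 'b vec"
      obtain x y where u: "u = (x, y)" by (cases u)
      have "dim_vec x = dim_vec y" if "u \<in> \<Phi> ` E" using that E carr u by fastforce
      then show "u \<in> ?L \<longleftrightarrow> u \<in> ?R" using swt_eq_0_iff[of x y] by (auto simp: u)
    qed
    also have "\<dots> = \<Phi> ` {x \<in> E. hamming_wt x \<noteq> 0}"
      using swt E by auto
    finally have "swt ` {(x, y) \<in> \<Phi> ` E. (x, y) \<noteq> (0\<^sub>v (dim_vec x), 0\<^sub>v (dim_vec y))} =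
        swt ` \<Phi> ` {x \<in> E. hamming_wt x \<noteq> 0}"
      by (rule arg_cong)
    also have "\<dots> = hamming_wt ` {x \<in> E. x \<noteq> 0\<^sub>v (dim_vec x)}"
      unfolding image_image using swt E by (intro image_cong) (auto simp: hamming_wt_eq_0_iff)
    finally show ?thesis by (simp add: min_swt_def min_wt_def)
  qed
  define U where "U = \<Phi> ` C"
  have V: "U \<inter> symplectic_dual n U = \<Phi> ` D"
    unfolding U_def dual[OF C] D(1) using inj subC subH by (intro inj_on_image_Int[symmetric])
  have additive: "additive_code n U"
    unfolding additive_code_def
  proof (intro conjI ballI)
    show "U \<subseteq> carrier_vec n \<times> carrier_vec n"
      unfolding U_def using carr subC by (intro image_subsetI) blast
    show "(0\<^sub>v n, 0\<^sub>v n) \<in> U"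
      using C zero unfolding U_def linear_code_def by (metis imageI)
    fix u assume "u \<in> U"
    then obtain x where x: "x \<in> C" "u = \<Phi> x" by (auto simp: U_def)
    then have xc: "x \<in> carrier_vec n" using subC by auto
    \<comment> \<open>Negation comes from linearity: \<open>(- 1) \<cdot>\<^sub>v x\<close> lies in
      \<open>C\<close>, and additivity makes its image the additive inverse of that of
      \<open>x\<close>.\<close>
    have "case \<Phi> x of (x, y) \<Rightarrow> (- x, - y) \<in> U"
    proof -
      let ?m = "(- 1) \<cdot>\<^sub>v x"
      have m: "?m \<in> C" using C x by (auto simp: linear_code_def)
      have "x + ?m = 0\<^sub>v n" using xc by (intro eq_vecI) auto
      moreover have "?m \<in> carrier_vec n" using xc by simp
      ultimately have "(fst (\<Phi> x) + fst (\<Phi> ?m), snd (\<Phi> x) + snd (\<Phi> ?m)) = (0\<^sub>v n, 0\<^sub>v n)"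
        using add[OF xc, of ?m] zero by metis
      then have sum: "fst (\<Phi> x) + fst (\<Phi> ?m) = 0\<^sub>v n" "snd (\<Phi> x) + snd (\<Phi> ?m) = 0\<^sub>v n"
        by (simp_all only: prod.inject)
      have neg: "- a = b" if "a + b = 0\<^sub>v n" "a \<in> carrier_vec n" "b \<in> carrier_vec n" for a b :: "'b vec"
      proof (rule eq_vecI)
        fix i assume i: "i < dim_vec b"
        have "a $ i + b $ i = (a + b) $ i" using i by simp
        also have "\<dots> = 0" unfolding that(1) using i that(3) by simp
        finally show "(- a) $ i = b $ i" using i that(2,3) by (simp add: neg_eq_iff_add_eq_0)
      qed (use that in auto)
      have "\<Phi> ?m = (- fst (\<Phi> x), - snd (\<Phi> x))"
        using neg[OF sum(1)] neg[OF sum(2)] carr[OF xc] carr[of ?m] xc by (simp add: mem_Times_iff prod_eq_iff)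
      then have "(- fst (\<Phi> x), - snd (\<Phi> x)) \<in> U" using m unfolding U_def by (metis imageI)
      then show ?thesis by (simp add: case_prod_beta)
    qed
    then show "case u of (x, y) \<Rightarrow> (- x, - y) \<in> U" using x by simp
    show "case u of (x, y) \<Rightarrow> \<forall>(x', y')\<in>U. (x + x', y + y') \<in> U"
    proof -
      have "(fst (\<Phi> x) + fst (\<Phi> y), snd (\<Phi> x) + snd (\<Phi> y)) \<in> U" if "y \<in> C" for y
      proof -
        have "x + y \<in> C" using C x that by (auto simp: linear_code_def)
        moreover have "y \<in> carrier_vec n" using that subC by auto
        ultimately show ?thesis unfolding U_def using add[OF xc, of y] by (metis imageI)
      qed
      then show ?thesis by (auto simp: x U_def case_prod_beta)
    qed
  qed
  have "card (\<Phi> ` C) = card C" "card (\<Phi> ` D) = card D"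
    by (rule card_image[OF inj_on_subset[OF inj subC]], rule card_image[OF inj_on_subset[OF inj subD]])
  have "q > 0" using q(1) by (rule primepow_gt_0_nat)
  then have pos: "K \<noteq> 0" "R \<noteq> 0" using card_D by (metis mult_0_right mult_0 power_not_zero less_not_refl)+
  have "real (card C) * real K = real q ^ n * real R" "real (card D) * (real K * real R) = real q ^ n"
    using card_C card_D by (metis of_nat_mult of_nat_power)+
  then have cards: "real (card U) = real CARD('b) ^ n * real R / real K"
      "real (card (\<Phi> ` D)) = real CARD('b) ^ n / (real K * real R)"
    using pos \<open>card (\<Phi> ` C) = card C\<close> \<open>card (\<Phi> ` D) = card D\<close>
    by (simp_all add: U_def q(3) nonzero_eq_divide_eq)
  have ne': "symplectic_dual n (\<Phi> ` D) \<noteq> U"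
    unfolding dual[OF D(2)] U_def using inj_on_image_eq_iff[OF inj subH subC] ne by blast
  have "symplectic_dual n (\<Phi> ` D) - U = \<Phi> ` (hermitian_dual q n D - C)"
    unfolding dual[OF D(2)] U_def using inj_on_image_set_diff[OF inj _ subC] subH by blast
  then have "min_swt (symplectic_dual n (\<Phi> ` D) - U) = min_wt (hermitian_dual q n D - C)"
    using min[of "hermitian_dual q n D - C"] subH by fastforce
  then have "subsystem_code n K R (min_wt (hermitian_dual q n D - C)) U"
    unfolding subsystem_code_def Let_def V using additive cards ne' by simp
  then show ?thesis by blast
qed

section \<open>Zeros and parameters of the code obtained by removing \<open>S\<close>\<close>

theorem proposition6:
  fixes q n :: nat
    and \<alpha> :: "'a :: {finite, field} alg_closure"
    and D :: "'a vec set"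
    and T :: "nat set"
  assumes "primepow q" "CARD('a) = q\<^sup>2" "CARD('b :: {finite, field}) = q"
    and "n > 0" "gcd n q = 1"
    and "primitive_root_of_unity n \<alpha>"
    and "cyclic_code n D" "D \<subseteq> hermitian_dual q n D"
    and "T \<subseteq> defining_set \<alpha> n D - defining_set \<alpha> n (hermitian_dual q n D)"
    and "union_of_cyclotomic_cosets q n T"
  shows "(\<exists>C. cyclic_code n C \<and>
            defining_set \<alpha> n C = defining_set \<alpha> n D - (T \<union> set_mult_mod n (- int q) T)) \<and>
         (\<forall>C k r d.
            cyclic_code n C \<longrightarrow>
            defining_set \<alpha> n C = defining_set \<alpha> n D - (T \<union> set_mult_mod n (- int q) T) \<longrightarrow>
            k \<le> n \<longrightarrow>
            n - k = card (defining_set \<alpha> n D) \<longrightarrow>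
            r = card (T \<union> set_mult_mod n (- int q) T) \<longrightarrow>
            r < n - 2 * k \<longrightarrow>
            d = min_wt (hermitian_dual q n D - C) \<longrightarrow>
            subsystem_code_exists TYPE('b) n (n - 2 * k - r) r d)"
proof -
  have primepow: "primepow CARD('a)"
    using assms(1,2) primepow_gt_0_nat[OF assms(1)] by (simp add: primepow_power_iff_nat)
  have coprime: "coprime n q" using assms(5) by (simp only: coprime_iff_gcd_eq_1)
  interpret hermitian_root_of_unity n \<alpha> q
    by (unfold_locales, fact assms(4), fact assms(6), fact primepow, fact assms(2), fact coprime)
  define TD where "TD = defining_set \<alpha> n D"
  define S where "S = T \<union> \<sigma> ` T"
  have S_eq: "T \<union> set_mult_mod n (- int q) T = S"
    by (simp add: S_def set_mult_mod_eq)
  have TD: "TD \<subseteq> {..<n}" using mem_defining_set_iff[OF assms(7)] by (auto simp: TD_def)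
  have dual: "cyclic_code n (hermitian_dual q n D)"
      "defining_set \<alpha> n (hermitian_dual q n D) = {..<n} - \<sigma> ` TD"
    using defining_set_hermitian_dual[OF assms(7)] by (simp_all add: TD_def)
  \<comment> \<open>Inclusion of codes reverses inclusion of zero sets.\<close>
  have dual_sub: "{..<n} - \<sigma> ` TD \<subseteq> TD"
  proof
    fix t assume "t \<in> {..<n} - \<sigma> ` TD"
    then have "t < n" "\<forall>c\<in>hermitian_dual q n D. code_eval c (\<alpha> ^ t) = 0"
      unfolding dual(2)[symmetric] mem_defining_set_iff[OF dual(1)] by simp_all
    then show "t \<in> TD"
      unfolding TD_def mem_defining_set_iff[OF assms(7)] using assms(8) by blast
  qed
  have T: "T \<subseteq> {..<n}" "T \<subseteq> TD" "T \<subseteq> \<sigma> ` TD"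
    using assms(9) TD unfolding dual(2) TD_def[symmetric] by blast+
  \<comment> \<open>As \<open>t\<close> is not a zero of the dual it is \<open>\<sigma> u\<close>
    with \<open>u\<close> in \<open>TD\<close>; then \<open>\<sigma> t\<close> is \<open>u\<close>
    times q^2, again in \<open>TD\<close>.\<close>
  have "\<sigma> t \<in> TD" if t: "t \<in> T" for t
  proof -
    obtain u where u: "u \<in> TD" "t = \<sigma> u" using T(3) t by blast
    then show ?thesis
      using mod_CARD_mem_defining_set_iff[OF assms(7), of u] TD by (auto simp: \<sigma>_\<sigma> TD_def)
  qed
  then have S: "S \<subseteq> TD" "S \<subseteq> \<sigma> ` TD" using T by (auto simp: S_def)
  have finite_TD: "finite TD" by (rule finite_subset[OF TD]) simp
  have finite_S: "finite S" by (rule finite_subset[OF S(1) finite_TD])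
  have "\<sigma> ` S \<subseteq> S"
    using T(1) mod_CARD_mem_union_of_cosets_iff[OF assms(10)] by (auto simp: S_def \<sigma>_\<sigma>)
  moreover have "inj_on \<sigma> S" by (rule inj_on_subset[OF inj_\<sigma> subset_trans[OF S(1) TD]])
  ultimately have \<sigma>S: "\<sigma> ` S = S" by (rule endo_inj_surj[OF finite_S])
  have closed: "t * CARD('a) mod n \<in> TD - S" if "t \<in> TD - S" for t
  proof -
    have "t < n" using that TD by auto
    then show ?thesis
      using that mod_CARD_mem_defining_set_iff[OF assms(7)] mod_CARD_mem_union_of_cosets_iff[OF assms(10)]
        mod_CARD_mem_\<sigma>_image_iff[OF assms(10) T(1)]
      by (auto simp: S_def TD_def)
  qed
  have "cyclic_code n (code_of (TD - S)) \<and> defining_set \<alpha> n (code_of (TD - S)) = TD - S"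
    using cyclic_code_code_of defining_set_eqI[OF is_defining_set_code_of[of "TD - S"]] closed TD by auto
  moreover have "subsystem_code_exists TYPE('b) n (n - 2 * k - r) r d"
    if C: "cyclic_code n C" "defining_set \<alpha> n C = TD - S"
      and k: "k \<le> n" "n - k = card TD" and r: "r = card S" "r < n - 2 * k"
      and d: "d = min_wt (hermitian_dual q n D - C)" for C k r d
  proof -
    have linear: "linear_code n C" "linear_code n D"
      using C(1) assms(7) by (simp_all add: cyclic_code_def)
    have "hermitian_dual q n C = code_of ({..<n} - \<sigma> ` (TD - S))"
      using hermitian_dual_cyclic[OF C(1)] C(2) by simp
    also have "{..<n} - \<sigma> ` (TD - S) = ({..<n} - \<sigma> ` TD) \<union> S"
    proof -
      have "\<sigma> ` (TD - S) = \<sigma> ` TD - \<sigma> ` S"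
        by (rule inj_on_image_set_diff[OF inj_\<sigma>]) (use TD S in auto)
      then show ?thesis using S TD by (auto simp: \<sigma>S)
    qed
    finally have "C \<inter> hermitian_dual q n C = code_of ((TD - S) \<union> (({..<n} - \<sigma> ` TD) \<union> S))"
      using cyclic_code_eq_code_of[OF C(1)] C(2) by (simp only: code_of_Un)
    also have "(TD - S) \<union> (({..<n} - \<sigma> ` TD) \<union> S) = TD" using S dual_sub by blast
    finally have D: "D = C \<inter> hermitian_dual q n C"
      using cyclic_code_eq_code_of[OF assms(7)] by (simp add: TD_def)
    have card_TC: "card (TD - S) = n - k - r" and "r \<le> n - k"
      using finite_S finite_TD S k r card_mono[of TD S] by (simp_all add: card_Diff_subset)
    have cardC: "card C = q ^ (2 * (k + r))"
    proof -
      have "n - (n - k - r) = k + r" using k r by simp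
      then show ?thesis
        using card_code[OF is_defining_set_defining_set[OF C(1)]] card_TC
        by (simp only: C(2) assms(2) power_mult)
    qed
    have cardD: "card D = q ^ (2 * k)"
    proof -
      have "n - card TD = k" using k by simp
      then show ?thesis
        using card_code[OF is_defining_set_defining_set[OF assms(7)]]
        by (simp only: TD_def assms(2) power_mult)
    qed
    have cardH: "card (hermitian_dual q n D) = q ^ (2 * (n - k))"
    proof -
      have "card (\<sigma> ` TD) = n - k"
        unfolding k(2) by (rule card_image[OF inj_on_subset[OF inj_\<sigma> TD]])
      moreover have "\<sigma> ` TD \<subseteq> {..<n}" using \<sigma>_less by auto
      ultimately have "card ({..<n} - \<sigma> ` TD) = k"
        using k(1) finite_TD by (simp add: card_Diff_subset)
      then show ?thesis
        using card_code[OF is_defining_set_defining_set[OF dual(1)]]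
        by (simp only: dual(2) assms(2) power_mult)
    qed
    have q1: "q > 1" using primepow_gt_Suc_0[OF assms(1)] by simp
    \<comment> \<open>Equal sizes would give n = 2k + r, which the strict bound on \<open>r\<close>
      excludes; with truncated subtraction that bound still means 2k + r < n.\<close>
    have "hermitian_dual q n D \<noteq> C"
    proof
      assume "hermitian_dual q n D = C"
      then have "q ^ (2 * (n - k)) = q ^ (2 * (k + r))" using cardH cardC by simp
      then have "n - k = k + r" using q1 by simp
      then show False using r by simp
    qed
    moreover have "card C * q ^ (n - 2 * k - r) = q ^ n * q ^ r"
      unfolding cardC power_add[symmetric] using r by (intro arg_cong[of _ _ "power q"]) simp
    moreover have "card D * (q ^ (n - 2 * k - r) * q ^ r) = q ^ n"
      unfolding cardD power_add[symmetric] using r by (intro arg_cong[of _ _ "power q"]) simp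
    ultimately have "\<exists>U :: ('b vec \<times> 'b vec) set. subsystem_code n (q ^ (n - 2 * k - r)) (q ^ r) d U"
      unfolding d using D linear by (intro subsystem_code_of_hermitian[OF assms(1-3)])
    then show ?thesis by (simp only: subsystem_code_exists_def assms(3))
  qed
  ultimately show ?thesis
    unfolding S_eq TD_def[symmetric] by blast
qed

end
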